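(* Let $\Omega_1=(0,\infty)\times\mathbb{R}$, so $\overline{\Omega}_1=[0,\infty)\times\mathbb{R}$ (variables $(x,t)$). Let $\{r_k\}_{k=1}^\infty$ be an enumeration of all rational numbers (i.e. $k\mapsto r_k$ is a bijection from $\mathbb{Z}^+$ onto $\mathbb{Q}$). Define $u_1,u_2:\overline{\Omega}_1\to\mathbb{R}$ by $$u_1(x,t)=\sum_{k=1}^\infty e^{-2^k}e^{-2^k x}\sin\big(2^{2k+1}t-2^k x\big),\qquad u_2(x,t)=\sum_{k=1}^\infty 2^{-k}\,\Phi(x+1,t-r_k).$$ Then for $i=1,2$: $u_i\in C^\infty(\overline{\Omega}_1)\cap L^\infty(\Omega_1)$ and $u_i$ satisfies the heat equation $\partial_t u_i-\partial_x^2u_i=0$ on $\overline{\Omega}_1$. However, for every fixed $x_0\in[0,\infty)$, the function $t\mapsto u_i(x_0,t)$ is not real analytic at any point $t_0\in\mathbb{R}$.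
   Context: $\Phi$ denotes the one-dimensional heat kernel: $\Phi(x,t)=(4\pi t)^{-1/2}\exp\!\big(-\tfrac{x^2}{4t}\big)$ for $x\in\mathbb{R}$, $t>0$, and $\Phi(x,t)=0$ for $x\in\mathbb{R}$, $t\le 0$. A function of $t$ is real analytic at $t_0$ if its Taylor series at $t_0$ has positive radius of convergence and converges to the function on a neighborhood of $t_0$. *)

theory Defs
  imports "HOL-Analysis.Analysis"
begin

definition heat_kernel :: "real \<Rightarrow> real \<Rightarrow> real" where
  "heat_kernel x t = (if t > 0 then (4 * pi * t) powr (-1/2) * exp (- (x\<^sup>2) / (4 * t)) else 0)"

definition Omega1 :: "(real \<times> real) set" where
  "Omega1 = {p. fst p > 0}"

definition Omega1_closure :: "(real \<times> real) set" where
  "Omega1_closure = {p. fst p \<ge> 0}"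

definition px :: "(real \<times> real \<Rightarrow> real) \<Rightarrow> real \<times> real \<Rightarrow> real" where
  "px f p = deriv (\<lambda>y. f (y, snd p)) (fst p)"

definition pt :: "(real \<times> real \<Rightarrow> real) \<Rightarrow> real \<times> real \<Rightarrow> real" where
  "pt f p = deriv (\<lambda>s. f (fst p, s)) (snd p)"

fun pD :: "bool list \<Rightarrow> (real \<times> real \<Rightarrow> real) \<Rightarrow> real \<times> real \<Rightarrow> real" where
  "pD [] f = f"
| "pD (True # ws) f = px (pD ws f)"
| "pD (False # ws) f = pt (pD ws f)"

definition C_inf_on :: "(real \<times> real) set \<Rightarrow> (real \<times> real \<Rightarrow> real) \<Rightarrow> bool" where
  "C_inf_on U f \<longleftrightarrow> (\<forall>ws. pD ws f differentiable_on U)"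

definition smooth_heat_on_closed :: "(real \<times> real) set \<Rightarrow> (real \<times> real \<Rightarrow> real) \<Rightarrow> bool" where
  "smooth_heat_on_closed S u \<longleftrightarrow>
     (\<exists>U g. open U \<and> S \<subseteq> U \<and> C_inf_on U g \<and> (\<forall>p\<in>S. g p = u p) \<and>
            (\<forall>p\<in>S. pt g p - px (px g) p = 0))"

definition smooth_on_closed :: "(real \<times> real) set \<Rightarrow> (real \<times> real \<Rightarrow> real) \<Rightarrow> bool" where
  "smooth_on_closed S u \<longleftrightarrow>
     (\<exists>U g. open U \<and> S \<subseteq> U \<and> C_inf_on U g \<and> (\<forall>p\<in>S. g p = u p))"

definition Linf_on :: "(real \<times> real) set \<Rightarrow> (real \<times> real \<Rightarrow> real) \<Rightarrow> bool" where
  "Linf_on S u \<longleftrightarrow> set_borel_measurable lebesgue S u \<and>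
     (\<exists>B. AE p in lebesgue. p \<in> S \<longrightarrow> \<bar>u p\<bar> \<le> B)"

definition real_analytic_at :: "(real \<Rightarrow> real) \<Rightarrow> real \<Rightarrow> bool" where
  "real_analytic_at f t0 \<longleftrightarrow>
     (\<exists>r>0. (\<forall>n. \<forall>t\<in>ball t0 r. ((deriv ^^ n) f has_real_derivative (deriv ^^ Suc n) f t) (at t)) \<and>
            (\<forall>t\<in>ball t0 r. (\<lambda>n. (deriv ^^ n) f t0 / fact n * (t - t0) ^ n) sums f t))"

text \<open>The two examples; the summation index k = 1,2,... is written as Suc k, k = 0,1,...\<close>
definition u1 :: "real \<times> real \<Rightarrow> real" where
  "u1 p = (\<Sum>k. exp (- (2 ^ Suc k)) * exp (- (2 ^ Suc k) * fst p)
                 * sin (2 ^ (2 * Suc k + 1) * snd p - 2 ^ Suc k * fst p))"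

definition u2 :: "(nat \<Rightarrow> real) \<Rightarrow> real \<times> real \<Rightarrow> real" where
  "u2 r p = (\<Sum>k. (1/2) ^ Suc k * heat_kernel (fst p + 1) (snd p - r (Suc k)))"

end

theory Submission
  imports Defs "HOL-Complex_Analysis.Complex_Analysis" "HOL-Real_Asymp.Real_Asymp"
begin

text \<open>Both functions are series of smooth solutions whose derivatives of every order converge uniformly near each
  point with \<open>x > -1\<close>. By Cauchy's estimates, analyticity of \<open>f\<close> at \<open>t0\<close> bounds its \<open>n\<close>-th derivative near \<open>t0\<close> by
  \<open>C n! B ^ n\<close>. For \<open>u1\<close>, the \<open>n\<close>-th time derivative with \<open>n\<close> close to \<open>2 ^ k (1 + x) / 2\<close> is dominated by the \<open>k\<close>-th
  term, whose size is \<open>n ^ (2 n)\<close> up to geometric factors. For \<open>u2\<close>, the derivatives are evaluated just after the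
  starting time of one source near \<open>t0\<close>, where its non-analyticity cannot be compensated by the other sources.\<close>

section \<open>Termwise differentiation\<close>

text \<open>The factor \<open>exp (- 2 ^ k)\<close> in \<open>u1\<close> and the shift
  \<open>x + 1\<close> in \<open>u2\<close> turn the boundary x = 0 into an interior line of the
  region x > -1. All derivatives are therefore ordinary two-sided ones, and each function is its own
  smooth extension. For \<open>u1\<close> the obstacle is the phase: the dominant term carries a
  trigonometric factor that may vanish for one order \<open>n\<close>. Raising the order by one
  exchanges sine and cosine, so two consecutive orders are played against each other. For
  \<open>u2\<close> the obstacle is density: every neighbourhood of a starting time contains
  infinitely many others, so no source can be isolated in time. What separates them is their
  weights. The argument needs the Cauchy bound on a whole neighbourhood of \<open>t0\<close>, since
  the derivatives are evaluated next to a starting time and not at \<open>t0\<close> itself.\<close>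

lemma suminf_has_derivative:
  fixes f :: "nat \<Rightarrow> real \<times> real \<Rightarrow> real"
  assumes V: "open V" "p \<in> V"
    and der: "\<And>k q. q \<in> V \<Longrightarrow> (f k has_derivative (\<lambda>h. fx k q * fst h + ft k q * snd h)) (at q)"
    and bd: "summable M" "\<And>k q. q \<in> V \<Longrightarrow> \<bar>f k q\<bar> \<le> M k"
    and bdx: "summable X" "\<And>k q. q \<in> V \<Longrightarrow> \<bar>fx k q\<bar> \<le> X k"
    and bdt: "summable T" "\<And>k q. q \<in> V \<Longrightarrow> \<bar>ft k q\<bar> \<le> T k"
  shows "((\<lambda>q. \<Sum>k. f k q) has_derivative
           (\<lambda>h. (\<Sum>k. fx k p) * fst h + (\<Sum>k. ft k p) * snd h)) (at p)"
proof -
  obtain e where e: "e > 0" "ball p e \<subseteq> V"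
    using V openE by blast
  let ?S = "ball p e"
  have pS: "p \<in> ?S" using e by simp
  have sm: "summable (\<lambda>k. f k q)" if "q \<in> ?S" for q
    by (rule summable_comparison_test'[OF bd(1), of 0]) (use bd(2)[of q] that e in \<open>auto simp: subset_iff simp del: split_paired_All\<close>)
  have ux: "uniform_limit ?S (\<lambda>n q. \<Sum>k<n. fx k q) (\<lambda>q. \<Sum>k. fx k q) sequentially"
    by (rule Weierstrass_m_test[OF _ bdx(1)]) (use e bdx in auto)
  have ut: "uniform_limit ?S (\<lambda>n q. \<Sum>k<n. ft k q) (\<lambda>q. \<Sum>k. ft k q) sequentially"
    by (rule Weierstrass_m_test[OF _ bdt(1)]) (use e bdt in auto)
  define g' where "g' = (\<lambda>q h. (\<Sum>k. fx k q) * fst h + (\<Sum>k. ft k q) * snd (h::real\<times>real))"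
  \<comment> \<open>Termwise differentiation takes place on a convex set, hence the passage from
    \<open>V\<close> to a ball. Uniform convergence of the derivatives as linear maps follows from
    that of the two coefficient series, each within \<open>d/2\<close>.\<close>
  have "\<exists>g. \<forall>q\<in>?S. (\<lambda>n. f n q) sums (g q) \<and> (g has_derivative g' q) (at q within ?S)"
  proof (rule has_derivative_series[OF convex_ball])
    show "(f n has_derivative (\<lambda>h. fx n q * fst h + ft n q * snd h)) (at q within ?S)"
      if "q \<in> ?S" for n q
      using der[of q n] that e has_derivative_at_withinI by blast
    show "\<forall>\<^sub>F n in sequentially. \<forall>q\<in>?S. \<forall>h. norm ((\<Sum>i<n. fx i q * fst h + ft i q * snd h) - g' q h) \<le> d * norm h"
      if d: "d > 0" for d
    proof -
      have "\<forall>\<^sub>F n in sequentially. \<forall>q\<in>?S. dist (\<Sum>k<n. fx k q) (\<Sum>k. fx k q) < d/2"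
        "\<forall>\<^sub>F n in sequentially. \<forall>q\<in>?S. dist (\<Sum>k<n. ft k q) (\<Sum>k. ft k q) < d/2"
        using uniform_limitD[OF ux, of "d/2"] uniform_limitD[OF ut, of "d/2"] d by simp_all
      then show ?thesis
      proof eventually_elim
        case (elim n)
        show ?case
        proof (intro ballI allI)
          fix q h assume q: "q \<in> ?S"
          let ?a = "(\<Sum>k<n. fx k q) - (\<Sum>k. fx k q)" and ?b = "(\<Sum>k<n. ft k q) - (\<Sum>k. ft k q)"
          have ab: "\<bar>?a\<bar> \<le> d/2" "\<bar>?b\<bar> \<le> d/2"
            using elim q by (force simp: dist_real_def)+
          have h: "\<bar>fst h\<bar> \<le> norm h" "\<bar>snd h\<bar> \<le> norm h"
            using norm_fst_le[of "fst h" "snd h"] norm_snd_le[of "snd h" "fst h"] by simp_all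
          have "(\<Sum>i<n. fx i q * fst h + ft i q * snd h) - g' q h = ?a * fst h + ?b * snd h"
            by (simp add: g'_def sum.distrib left_diff_distrib flip: sum_distrib_right)
          also have "norm \<dots> \<le> \<bar>?a\<bar> * \<bar>fst h\<bar> + \<bar>?b\<bar> * \<bar>snd h\<bar>"
            using abs_triangle_ineq[of "?a * fst h" "?b * snd h"] by (simp only: real_norm_def abs_mult)
          also have "\<dots> \<le> d/2 * norm h + d/2 * norm h"
            using ab h d by (intro add_mono mult_mono) auto
          finally show "norm ((\<Sum>i<n. fx i q * fst h + ft i q * snd h) - g' q h) \<le> d * norm h"
            by simp
        qed
      qed
    qed
    show "(\<lambda>n. f n p) sums (\<Sum>k. f k p)" "p \<in> ?S"
      using sm[OF pS] pS summable_sums by auto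
  qed
  then obtain g where g: "\<And>q. q \<in> ?S \<Longrightarrow> (\<lambda>n. f n q) sums (g q)"
      "\<And>q. q \<in> ?S \<Longrightarrow> (g has_derivative g' q) (at q within ?S)" by blast
  have "(g has_derivative g' p) (at p)"
    using g(2)[OF pS] at_within_open[OF pS open_ball] by metis
  then have "((\<lambda>q. \<Sum>k. f k q) has_derivative g' p) (at p)"
    by (rule has_derivative_transform_within_open[OF _ open_ball pS])
       (use g(1) sums_unique in auto)
  then show ?thesis by (simp add: g'_def)
qed

lemma partial_derivs_from_has_derivative:
  fixes f :: "real \<times> real \<Rightarrow> real"
  assumes "(f has_derivative (\<lambda>h. a * fst h + b * snd h)) (at p)"
  shows "((\<lambda>y. f (y, snd p)) has_real_derivative a) (at (fst p))"
    and "((\<lambda>s. f (fst p, s)) has_real_derivative b) (at (snd p))"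
proof -
  have 1: "((\<lambda>y. (y, snd p)) has_derivative (\<lambda>h. (h, 0))) (at (fst p))"
    by (intro has_derivative_Pair has_derivative_ident has_derivative_const)
  have 2: "((\<lambda>s. (fst p, s)) has_derivative (\<lambda>h. (0, h))) (at (snd p))"
    by (intro has_derivative_Pair has_derivative_ident has_derivative_const)
  show "((\<lambda>y. f (y, snd p)) has_real_derivative a) (at (fst p))"
    using has_derivative_compose[OF 1, of f "\<lambda>h. a * fst h + b * snd h"] assms
    by (simp add: has_field_derivative_def)
  show "((\<lambda>s. f (fst p, s)) has_real_derivative b) (at (snd p))"
    using has_derivative_compose[OF 2, of f "\<lambda>h. a * fst h + b * snd h"] assms
    by (simp add: has_field_derivative_def)
qed

text \<open>Prefixing a letter to \<open>ws\<close> means one more differentiation. A partial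
  derivative at \<open>p\<close> depends on values near \<open>p\<close>, so the identity must be
  known on all of \<open>U\<close> before the next derivative is taken; the induction keeps
  \<open>p\<close> general for this reason.\<close>

lemma pD_eq_family:
  fixes G :: "bool list \<Rightarrow> real \<times> real \<Rightarrow> real"
  assumes U: "open U"
    and der: "\<And>ws p. p \<in> U \<Longrightarrow>
      (G ws has_derivative (\<lambda>h. G (True # ws) p * fst h + G (False # ws) p * snd h)) (at p)"
    and p: "p \<in> U"
  shows "pD ws (G []) p = G ws p"
  using p
proof (induction ws arbitrary: p)
  case Nil
  then show ?case by simp
next
  case (Cons b ws)
  have "(pD ws (G []) has_derivative (\<lambda>h. G (True # ws) p * fst h + G (False # ws) p * snd h)) (at p)"
    by (rule has_derivative_transform_within_open[OF der[OF Cons.prems] U Cons.prems])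
       (simp add: Cons.IH)
  from partial_derivs_from_has_derivative[OF this]
  show ?case
    by (cases b) (auto simp: px_def pt_def intro: DERIV_imp_deriv)
qed

lemma C_inf_on_family:
  fixes G :: "bool list \<Rightarrow> real \<times> real \<Rightarrow> real"
  assumes U: "open U"
    and der: "\<And>ws p. p \<in> U \<Longrightarrow>
      (G ws has_derivative (\<lambda>h. G (True # ws) p * fst h + G (False # ws) p * snd h)) (at p)"
  shows "C_inf_on U (G [])"
  unfolding C_inf_on_def differentiable_on_def
proof (intro allI ballI)
  fix ws p assume p: "p \<in> U"
  have "(pD ws (G []) has_derivative (\<lambda>h. G (True # ws) p * fst h + G (False # ws) p * snd h)) (at p)"
    by (rule has_derivative_transform_within_open[OF der[OF p] U p])
       (simp add: pD_eq_family[OF U der])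
  then show "pD ws (G []) differentiable at p within U"
    using differentiableI differentiable_at_withinI by blast
qed

text \<open>The dominated neighbourhood may depend on the word. One differentiation involves only
  three words, so three neighbourhoods are intersected.\<close>

lemma series_family_has_derivative:
  fixes F :: "nat \<Rightarrow> bool list \<Rightarrow> real \<times> real \<Rightarrow> real"
  assumes U: "open U"
    and der: "\<And>k ws p. p \<in> U \<Longrightarrow>
      (F k ws has_derivative (\<lambda>h. F k (True # ws) p * fst h + F k (False # ws) p * snd h)) (at p)"
    and bd: "\<And>ws p. p \<in> U \<Longrightarrow>
      \<exists>V M. open V \<and> p \<in> V \<and> summable M \<and> (\<forall>k. \<forall>q\<in>V. \<bar>F k ws q\<bar> \<le> M k)"
    and p: "p \<in> U"
  shows "((\<lambda>q. \<Sum>k. F k ws q) has_derivative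
      (\<lambda>h. (\<Sum>k. F k (True # ws) p) * fst h + (\<Sum>k. F k (False # ws) p) * snd h)) (at p)"
proof -
  obtain V M where M: "open V" "p \<in> V" "summable M" "\<And>k q. q \<in> V \<Longrightarrow> \<bar>F k ws q\<bar> \<le> M k"
    using bd[OF p] by meson
  obtain V1 M1 where M1: "open V1" "p \<in> V1" "summable M1"
      "\<And>k q. q \<in> V1 \<Longrightarrow> \<bar>F k (True # ws) q\<bar> \<le> M1 k"
    using bd[OF p] by meson
  obtain V2 M2 where M2: "open V2" "p \<in> V2" "summable M2"
      "\<And>k q. q \<in> V2 \<Longrightarrow> \<bar>F k (False # ws) q\<bar> \<le> M2 k"
    using bd[OF p] by meson
  show ?thesis
    by (rule suminf_has_derivative[where V = "U \<inter> V \<inter> V1 \<inter> V2", OF _ _ _ M(3) _ M1(3) _ M2(3)])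
       (use U p M M1 M2 der in auto)
qed

lemma iterated_deriv_eq_pD:
  "(deriv ^^ n) (\<lambda>s. u (x, s)) = (\<lambda>t. pD (replicate n False) u (x, t))"
  by (induction n) (auto simp: pt_def)

section \<open>Cauchy estimates\<close>

text \<open>Along the real line, differentiation commutes with taking the real part of a holomorphic
  extension; this carries Cauchy estimates over to real derivatives.\<close>

lemma iterated_deriv_Re:
  fixes f :: "real \<Rightarrow> real"
  assumes S: "open S" "g holomorphic_on S" and T: "open T" "of_real ` T \<subseteq> S"
    and eq: "\<And>t. t \<in> T \<Longrightarrow> f t = Re (g (of_real t))" and t: "t \<in> T"
  shows "(deriv ^^ n) f t = Re ((deriv ^^ n) g (of_real t))"
  using t
proof (induction n arbitrary: t)
  case 0
  then show ?case by (simp add: eq)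
next
  case (Suc n)
  have "(deriv ^^ n) g holomorphic_on S"
    by (rule holomorphic_higher_deriv[OF S(2,1)])
  then have "((deriv ^^ n) g has_field_derivative (deriv ^^ Suc n) g (of_real t)) (at (of_real t))"
    using S T Suc.prems holomorphic_derivI[of _ S] by (auto simp: image_subset_iff)
  then have "((\<lambda>s. (deriv ^^ n) g (of_real s)) has_vector_derivative (deriv ^^ Suc n) g (of_real t)) (at t)"
    by (rule has_vector_derivative_real_field)
  then have "((\<lambda>s. Re ((deriv ^^ n) g (of_real s))) has_real_derivative Re ((deriv ^^ Suc n) g (of_real t))) (at t)"
    by (metis has_field_derivative_Re)
  then have "((deriv ^^ n) f has_real_derivative Re ((deriv ^^ Suc n) g (of_real t))) (at t)"
    by (rule DERIV_cong_ev[THEN iffD1, rotated -1])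
       (use Suc T in \<open>auto simp: eventually_nhds intro!: exI[of _ T]\<close>)
  then show ?case by (simp add: DERIV_imp_deriv)
qed

text \<open>The Taylor series converges in the complex disc of radius \<open>r\<close> and extends
  \<open>f\<close> to a holomorphic \<open>g\<close>. For \<open>t\<close> within \<open>r/3\<close>
  of \<open>t0\<close>, the disc of radius \<open>r/3\<close> about \<open>t\<close> stays in the
  closed disc of radius \<open>2*r/3\<close>, where \<open>g\<close> is bounded, so Cauchy's
  inequality has constants independent of \<open>t\<close>.\<close>

lemma real_analytic_at_deriv_bound:
  assumes "real_analytic_at f t0"
  obtains \<rho> C B where "\<rho> > 0" "C \<ge> 0" "B > 0"
    "\<And>n t. \<bar>t - t0\<bar> < \<rho> \<Longrightarrow> \<bar>(deriv ^^ n) f t\<bar> \<le> C * fact n * B ^ n"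
proof -
  obtain r where r: "r > 0"
    and s: "\<And>t. t \<in> ball t0 r \<Longrightarrow> (\<lambda>n. (deriv ^^ n) f t0 / fact n * (t - t0) ^ n) sums f t"
    using assms unfolding real_analytic_at_def by blast
  define a where "a = (\<lambda>n. complex_of_real ((deriv ^^ n) f t0 / fact n))"
  define g where "g = (\<lambda>w. \<Sum>n. a n * (w - of_real t0) ^ n)"
  have sg: "(\<lambda>n. a n * (w - of_real t0) ^ n) sums g w" if w: "w \<in> ball (of_real t0) r" for w
  proof -
    \<comment> \<open>A radius strictly between the distance of \<open>w\<close> from the centre and
      \<open>r\<close>: convergence at the real point \<open>t0 + d\<close> forces convergence at
      \<open>w\<close>.\<close>
    define d where "d = (norm (w - of_real t0) + r) / 2"
    have d: "norm (w - of_real t0) < d" "d < r" "d > 0"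
      using w r by (auto simp: d_def dist_norm norm_minus_commute add_nonneg_pos)
    have "t0 + d \<in> ball t0 r" using d by (simp add: dist_real_def)
    from sums_summable[OF s[OF this]]
    have "summable (\<lambda>n. complex_of_real ((deriv ^^ n) f t0 / fact n * d ^ n))"
      by (simp only: summable_of_real_iff) simp
    then have "summable (\<lambda>n. a n * (of_real d) ^ n)"
      by (simp add: a_def)
    then have "summable (\<lambda>n. a n * (w - of_real t0) ^ n)"
      by (rule powser_inside) (use d in auto)
    then show ?thesis unfolding g_def by (rule summable_sums)
  qed
  have hol: "g holomorphic_on ball (of_real t0) r"
    by (rule power_series_holomorphic[OF sg])
  have eq: "f t = Re (g (of_real t))" if "t \<in> ball t0 r" for t
  proof -
    have "of_real t \<in> ball (complex_of_real t0) r"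
      using that by (simp add: dist_real_def dist_complex_def flip: of_real_diff)
    from sums_Re[OF sg[OF this]]
    have "(\<lambda>n. Re (a n * (of_real t - of_real t0) ^ n)) sums Re (g (of_real t))" .
    moreover have "a n * (of_real t - of_real t0) ^ n = of_real ((deriv ^^ n) f t0 / fact n * (t - t0) ^ n)" for n
      unfolding a_def by simp
    ultimately have "(\<lambda>n. (deriv ^^ n) f t0 / fact n * (t - t0) ^ n) sums Re (g (of_real t))"
      by (simp only: Re_complex_of_real)
    with s[OF that] show ?thesis by (rule sums_unique2)
  qed
  have der: "(deriv ^^ n) f t = Re ((deriv ^^ n) g (of_real t))" if "t \<in> ball t0 r" for n t
    by (rule iterated_deriv_Re[OF open_ball hol open_ball _ eq that])
       (auto simp: dist_real_def dist_complex_def simp flip: of_real_diff)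
  have "compact (g ` cball (of_real t0) (2*r/3))"
    by (intro compact_continuous_image continuous_on_subset[OF holomorphic_on_imp_continuous_on[OF hol]])
       (use r in auto)
  then obtain C where C: "C > 0" "\<And>z. z \<in> cball (of_real t0) (2*r/3) \<Longrightarrow> norm (g z) \<le> C"
    by (metis bounded_pos compact_imp_bounded image_eqI)
  have "\<bar>(deriv ^^ n) f t\<bar> \<le> C * fact n * (3/r) ^ n" if t: "\<bar>t - t0\<bar> < r/3" for n t
  proof -
    have sub: "cball (complex_of_real t) (r/3) \<subseteq> cball (of_real t0) (2*r/3)"
    proof -
      have "dist (complex_of_real t) (of_real t0) < r/3"
        using t by (simp add: dist_complex_def flip: of_real_diff)
      then show ?thesis by (simp add: cball_subset_cball_iff)
    qed
    have sub2: "cball (complex_of_real t0) (2*r/3) \<subseteq> ball (of_real t0) r"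
      using r by auto
    have "norm ((deriv ^^ n) g (of_real t)) \<le> fact n * C / (r/3) ^ n"
    proof (rule Cauchy_inequality)
      show "g holomorphic_on ball (of_real t) (r/3)"
        using hol sub sub2 ball_subset_cball holomorphic_on_subset by (metis subset_trans)
      show "continuous_on (cball (of_real t) (r/3)) g"
        using hol sub sub2 continuous_on_subset holomorphic_on_imp_continuous_on by (metis subset_trans)
      show "norm (g x) \<le> C" if "norm (of_real t - x) = r/3" for x
        using that sub by (intro C) (auto simp: dist_complex_def subset_iff)
    qed (use r in auto)
    then have "\<bar>Re ((deriv ^^ n) g (of_real t))\<bar> \<le> fact n * C / (r/3) ^ n"
      using abs_Re_le_cmod order_trans by blast
    moreover have "t \<in> ball t0 r" using t r by (simp add: dist_real_def abs_minus_commute)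
    ultimately show ?thesis by (simp add: der field_simps)
  qed
  then show ?thesis using that[of "r/3" C "3/r"] r C(1) by fastforce
qed

lemma power_le_fact_exp:
  fixes y :: real
  assumes "y \<ge> 0"
  shows "y ^ m \<le> fact m * exp y"
proof -
  have "(\<Sum>n\<in>{m}. y ^ n /\<^sub>R fact n) \<le> exp y"
    unfolding exp_def by (rule sum_le_suminf) (use assms summable_exp_generic[of y] in \<open>simp_all add: divide_inverse mult.commute\<close>)
  then show ?thesis by (simp add: field_simps)
qed

section \<open>The lacunary series\<close>

text \<open>The term with frequency \<open>a\<close> is the imaginary part of \<open>exp (- a - (1 + \<i>) a x + 2 \<i> a\<^sup>2 t)\<close>, so each partial
  derivative only contributes a constant complex factor. As in \<^const>\<open>pD\<close>, \<open>True\<close> stands for \<open>\<partial>\<^sub>x\<close> and \<open>False\<close> for \<open>\<partial>\<^sub>t\<close>.\<close>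
definition osc :: "real \<Rightarrow> bool list \<Rightarrow> real \<times> real \<Rightarrow> real" where
  "osc a ws p = Im (prod_list (map (\<lambda>b. if b then - ((1 + \<i>) * of_real a) else 2 * \<i> * of_real (a\<^sup>2)) ws)
     * exp (of_real (- a) - (1 + \<i>) * of_real a * of_real (fst p) + 2 * \<i> * of_real (a\<^sup>2) * of_real (snd p)))"

lemma osc_has_derivative:
  "(osc a ws has_derivative (\<lambda>h. osc a (True # ws) p * fst h + osc a (False # ws) p * snd h)) (at p)"
proof -
  define P where "P = prod_list (map (\<lambda>b. if b then - ((1 + \<i>) * of_real a) else 2 * \<i> * of_real (a\<^sup>2)) ws)"
  define E where "E = (\<lambda>p::real\<times>real. of_real (- a) - (1 + \<i>) * of_real a * of_real (fst p) + 2 * \<i> * of_real (a\<^sup>2) * of_real (snd p))"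
  have "(E has_derivative (\<lambda>h. - ((1 + \<i>) * of_real a) * of_real (fst h) + 2 * \<i> * of_real (a\<^sup>2) * of_real (snd h))) (at p)"
    unfolding E_def by (auto intro!: derivative_eq_intros has_derivative_of_real)
  from has_derivative_compose[OF this DERIV_exp[unfolded has_field_derivative_def]]
  have "((\<lambda>p. P * exp (E p)) has_derivative (\<lambda>h. P * ((- ((1 + \<i>) * of_real a) * of_real (fst h)
           + 2 * \<i> * of_real (a\<^sup>2) * of_real (snd h)) * exp (E p)))) (at p)"
    by (intro has_derivative_mult_right) (simp only: mult.commute)
  then have "((\<lambda>p. Im (P * exp (E p))) has_derivative (\<lambda>h. Im (P * ((- ((1 + \<i>) * of_real a) * of_real (fst h)
           + 2 * \<i> * of_real (a\<^sup>2) * of_real (snd h)) * exp (E p))))) (at p)"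
    by (rule has_derivative_Im)
  moreover have "(\<lambda>p. Im (P * exp (E p))) = osc a ws"
    by (simp add: osc_def P_def E_def fun_eq_iff)
  moreover have "Im (P * ((- ((1 + \<i>) * of_real a) * of_real (fst h) + 2 * \<i> * of_real (a\<^sup>2) * of_real (snd h)) * exp (E p)))
      = osc a (True # ws) p * fst h + osc a (False # ws) p * snd h" for h :: "real \<times> real"
  proof -
    have T: "osc a (True # ws) p = Im (- ((1 + \<i>) * of_real a) * P * exp (E p))"
      and F: "osc a (False # ws) p = Im (2 * \<i> * of_real (a\<^sup>2) * P * exp (E p))"
      by (simp_all only: osc_def P_def E_def list.map prod_list.Cons if_True if_False)
    have Im_real: "Im (z * of_real c) = Im z * c" for z c by simp
    have "P * ((- ((1 + \<i>) * of_real a) * of_real (fst h) + 2 * \<i> * of_real (a\<^sup>2) * of_real (snd h)) * exp (E p))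
        = (- ((1 + \<i>) * of_real a) * P * exp (E p)) * of_real (fst h) + (2 * \<i> * of_real (a\<^sup>2) * P * exp (E p)) * of_real (snd h)"
      by (simp add: algebra_simps)
    also have "Im \<dots> = osc a (True # ws) p * fst h + osc a (False # ws) p * snd h"
      by (simp only: Im_real T F plus_complex.sel)
    finally show ?thesis .
  qed
  ultimately show ?thesis by simp
qed

text \<open>This is the dispersion relation \<open>(1 + \<i>)^2 = 2 * \<i>\<close>.\<close>

lemma osc_heat: "osc a [False] p = osc a [True, True] p"
proof -
  have "((1 + \<i>) * of_real a) * ((1 + \<i>) * of_real a) = 2 * \<i> * of_real (a\<^sup>2)"
    by (simp add: algebra_simps power2_eq_square)
  then show ?thesis by (simp add: osc_def flip: mult.assoc)
qed

lemma exp_osc: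
  "exp (of_real (- a) - (1 + \<i>) * of_real a * of_real x + 2 * \<i> * of_real (a\<^sup>2) * of_real t)
     = of_real (exp (- (a * (1 + x)))) * cis (2 * a\<^sup>2 * t - a * x)"
proof -
  have "of_real (- a) - (1 + \<i>) * of_real a * of_real x + 2 * \<i> * of_real (a\<^sup>2) * of_real t
      = of_real (- (a * (1 + x))) + \<i> * of_real (2 * a\<^sup>2 * t - a * x)"
    by (simp add: algebra_simps)
  then show ?thesis by (simp only: exp_add exp_of_real cis_conv_exp)
qed

lemma osc_Nil: "osc a [] p = exp (- (a * (1 + fst p))) * sin (2 * a\<^sup>2 * snd p - a * fst p)"
  unfolding osc_def exp_osc by simp

lemma osc_time_derivs:
  "osc a (replicate n False) (x, t)
     = exp (- (a * (1 + x))) * (2 * a\<^sup>2) ^ n * Im (\<i> ^ n * cis (2 * a\<^sup>2 * t - a * x))"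
proof -
  have "(2 * \<i> * of_real (a\<^sup>2)) ^ n * (of_real (exp (- (a * (1 + x)))) * cis (2 * a\<^sup>2 * t - a * x))
      = of_real (exp (- (a * (1 + x))) * (2 * a\<^sup>2) ^ n) * (\<i> ^ n * cis (2 * a\<^sup>2 * t - a * x))"
    by (simp add: power_mult_distrib)
  moreover have "Im (of_real c * z) = c * Im z" for c z by simp
  ultimately show ?thesis
    unfolding osc_def fst_conv snd_conv exp_osc map_replicate if_False prod_list_replicate
    by presburger
qed

text \<open>For \<open>a \<ge> 1\<close> an x-derivative costs at most \<open>2 * a\<close>, hence
  at most \<open>2 * a^2\<close>, the cost of a t-derivative. The bound then sees only the length of
  the word.\<close>

lemma abs_osc_le:
  assumes "a \<ge> 1"
  shows "\<bar>osc a ws p\<bar> \<le> (2 * a\<^sup>2) ^ length ws * exp (- (a * (1 + fst p)))"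
proof -
  let ?P = "\<lambda>ws. prod_list (map (\<lambda>b. if b then - ((1 + \<i>) * of_real a) else 2 * \<i> * of_real (a\<^sup>2)) ws)"
  have a2: "a \<le> a\<^sup>2" using assms by (simp add: power2_eq_square)
  have "norm (1 + \<i>) \<le> 2"
    using norm_triangle_ineq[of 1 \<i>] by simp
  then have 1: "norm ((1 + \<i>) * of_real a) \<le> 2 * a\<^sup>2"
    using assms a2 by (auto simp: norm_mult intro!: mult_mono)
  have "norm (?P ws) \<le> (2 * a\<^sup>2) ^ length ws"
  proof (induction ws)
    case (Cons b ws)
    have "norm (if b then - ((1 + \<i>) * of_real a) else 2 * \<i> * of_real (a\<^sup>2)) \<le> 2 * a\<^sup>2"
      using 1 by (auto simp: norm_mult norm_power)
    then show ?case using Cons by (simp only: list.map prod_list.Cons norm_mult list.size power_Suc add_0_right add_Suc_right)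
       (auto intro!: mult_mono)
  qed simp
  then have "norm (?P ws * (of_real (exp (- (a * (1 + fst p)))) * cis (2 * a\<^sup>2 * snd p - a * fst p)))
      \<le> (2 * a\<^sup>2) ^ length ws * exp (- (a * (1 + fst p)))"
    by (simp add: norm_mult mult_right_mono)
  then show ?thesis
    unfolding osc_def exp_osc using abs_Im_le_cmod order_trans by blast
qed

lemma summable_osc_bound:
  assumes "d > 0"
  shows "summable (\<lambda>k. (2 * (2 ^ Suc k)\<^sup>2) ^ n * exp (- (2 ^ Suc k * d)) :: real)"
proof (rule summable_comparison_test')
  \<comment> \<open>The exponent \<open>2 * n + 1\<close> exceeds the degree \<open>2 * n\<close> of
    the polynomial factor by one; the spare power leaves \<open>1 / y\<close>, which is geometric in
    \<open>k\<close>.\<close>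
  define K :: real where "K = 2 ^ n * fact (2 * n + 1) / d ^ (2 * n + 1)"
  show "summable (\<lambda>k. K * (1/2) ^ Suc k :: real)"
    by (intro summable_mult) (simp only: summable_Suc_iff summable_geometric, simp)
  show "norm ((2 * (2 ^ Suc k)\<^sup>2) ^ n * exp (- (2 ^ Suc k * d)) :: real) \<le> K * (1/2) ^ Suc k" if "k \<ge> 0" for k :: nat
  proof -
    define y :: real where "y = 2 ^ Suc k"
    have y: "y > 0" by (simp add: y_def)
    have "(y * d) ^ (2 * n + 1) \<le> fact (2 * n + 1) * exp (y * d)"
      by (rule power_le_fact_exp) (use y assms in simp)
    then have "(y * d) ^ (2 * n + 1) * 2 ^ n \<le> fact (2 * n + 1) * exp (y * d) * 2 ^ n"
      by (rule mult_right_mono) simp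
    moreover have "(y * d) ^ (2 * n + 1) * 2 ^ n = y * (2 * y\<^sup>2) ^ n * d ^ (2 * n + 1)"
      by (simp add: power_mult_distrib power_mult)
    moreover have "d ^ (2 * n + 1) > 0" using assms by simp
    ultimately have "y * (2 * y\<^sup>2) ^ n \<le> fact (2 * n + 1) * exp (y * d) * 2 ^ n / d ^ (2 * n + 1)"
      by (simp only: pos_le_divide_eq)
    also have "\<dots> = K * exp (y * d)" by (simp add: K_def)
    finally have "y * (2 * y\<^sup>2) ^ n \<le> K * exp (y * d)" .
    then have "(2 * y\<^sup>2) ^ n * exp (- (y * d)) \<le> K * (1 / y)"
      using y by (simp add: exp_minus field_simps)
    moreover have "1 / y = (1/2) ^ Suc k" unfolding y_def power_one_over ..
    moreover have "norm ((2 * y\<^sup>2) ^ n * exp (- (y * d))) = (2 * y\<^sup>2) ^ n * exp (- (y * d))"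
      by simp
    ultimately have "norm ((2 * y\<^sup>2) ^ n * exp (- (y * d))) \<le> K * (1/2) ^ Suc k"
      by (simp only:)
    then show ?thesis unfolding y_def .
  qed
qed

section \<open>The terms of \<open>u1\<close> and their uniform bounds\<close>

abbreviation u1_term :: "nat \<Rightarrow> bool list \<Rightarrow> real \<times> real \<Rightarrow> real" where
  "u1_term k \<equiv> osc (2 ^ Suc k)"

lemma u1_eq: "u1 = (\<lambda>p. \<Sum>k. u1_term k [] p)"
proof -
  have "exp (- (2 ^ Suc k)) * exp (- (2 ^ Suc k) * x) * sin (2 ^ (2 * Suc k + 1) * t - 2 ^ Suc k * x)
      = u1_term k [] (x, t)" for k and x t :: real
  proof -
    have "(2::real) ^ (2 * Suc k + 1) = 2 * (2 ^ Suc k)\<^sup>2"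
      by (simp add: power_mult[symmetric] mult.commute)
    then show ?thesis
      by (simp only: osc_Nil fst_conv snd_conv distrib_left exp_add[symmetric]) (simp add: algebra_simps)
  qed
  then show ?thesis by (simp add: u1_def fun_eq_iff)
qed

lemma u1_term_bound:
  assumes "d > 0" "fst q > d - 1"
  shows "\<bar>u1_term k ws q\<bar> \<le> (2 * (2 ^ Suc k)\<^sup>2) ^ length ws * exp (- (2 ^ Suc k * d))"
proof -
  have "\<bar>u1_term k ws q\<bar> \<le> (2 * (2 ^ Suc k)\<^sup>2) ^ length ws * exp (- (2 ^ Suc k * (1 + fst q)))"
    by (rule abs_osc_le) (rule one_le_power, simp)
  also have "\<dots> \<le> (2 * (2 ^ Suc k)\<^sup>2) ^ length ws * exp (- (2 ^ Suc k * d))"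
    using assms by (intro mult_left_mono) auto
  finally show ?thesis .
qed

lemma open_halfplane: "open {p::real\<times>real. fst p > c}"
  by (intro open_Collect_less continuous_intros)

lemma u1_locally_dominated:
  assumes "p \<in> {p. fst p > -1}"
  shows "\<exists>V M. open V \<and> p \<in> V \<and> summable M \<and> (\<forall>k. \<forall>q\<in>V. \<bar>u1_term k ws q\<bar> \<le> M k)"
proof -
  define d where "d = (fst p + 1) / 2"
  have "d > 0" "fst p > d - 1" using assms by (auto simp: d_def field_simps)
  then show ?thesis
    using u1_term_bound[of d] summable_osc_bound[of d "length ws"] open_halfplane[of "d - 1"]
    by (intro exI[of _ "{p. fst p > d - 1}"] exI[of _ "\<lambda>k. (2 * (2 ^ Suc k)\<^sup>2) ^ length ws * exp (- (2 ^ Suc k * d))"]) auto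
qed

lemmas u1_family_has_derivative =
  series_family_has_derivative[where F = u1_term, OF open_halfplane osc_has_derivative u1_locally_dominated]

text \<open>\<open>T\<close> holds amplitudes and \<open>s\<close> phases. Growth by a factor 8
  before \<open>k\<close> and decay by a factor 8 after it make the terms on either side of
  \<open>k\<close> sum to at most \<open>T k * (1/8 + 1/64 + ...) = T k / 7\<close>, together
  \<open>2/7\<close> of \<open>T k\<close>.\<close>

lemma dominant_term:
  fixes T s :: "nat \<Rightarrow> real"
  assumes T: "\<And>j. T j \<ge> 0" and s: "\<And>j. \<bar>s j\<bar> \<le> 1"
    and up: "\<And>j. j < k \<Longrightarrow> 8 * T j \<le> T (Suc j)"
    and down: "\<And>j. k \<le> j \<Longrightarrow> 8 * T (Suc j) \<le> T j"
  shows "T k * (\<bar>s k\<bar> - 2/7) \<le> \<bar>\<Sum>j. T j * s j\<bar>"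
proof -
  have geo: "T (i + k) \<le> T k * (1/8) ^ i" for i
  proof (induction i)
    case (Suc i)
    then show ?case using down[of "i + k"] by simp
  qed simp
  have sg: "summable (\<lambda>i. T k * (1/8) ^ i :: real)"
    by (intro summable_mult) (simp add: summable_geometric)
  have absle: "\<bar>T j * s j\<bar> \<le> T j" for j
    using mult_left_mono[OF s T, of j j] T[of j] by (simp add: abs_mult)
  have "summable (\<lambda>i. T (i + k) * s (i + k))"
    by (rule summable_comparison_test'[OF sg, of 0]) (use order_trans[OF absle geo] in auto)
  then have sm: "summable (\<lambda>j. T j * s j)" using summable_iff_shift[of "\<lambda>j. T j * s j" k] by blast
  have head: "(\<Sum>j<m. T j) \<le> T m / 7" if "m \<le> k" for m
    using that
  proof (induction m)
    case 0
    then show ?case using T by simp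
  next
    case (Suc m)
    then show ?case using up[of m] by simp
  qed
  have "\<bar>\<Sum>j<k. T j * s j\<bar> \<le> (\<Sum>j<k. T j)"
    using sum_abs[of "\<lambda>j. T j * s j" "{..<k}"] sum_mono[of "{..<k}" "\<lambda>j. \<bar>T j * s j\<bar>" T, OF absle] by linarith
  then have h: "\<bar>\<Sum>j<k. T j * s j\<bar> \<le> T k / 7" using head[of k] by simp
  have "(\<lambda>i. T k * (1/8) * (1/8) ^ i) sums (T k * (1/8) * (1 / (1 - 1/8)))"
    by (intro sums_mult geometric_sums) simp
  then have g: "(\<lambda>i. T k * (1/8) ^ Suc i) sums (T k / 7)" by simp
  have "norm (\<Sum>i. T (i + Suc k) * s (i + Suc k)) \<le> (\<Sum>i. T k * (1/8) ^ Suc i)"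
  proof (rule norm_suminf_le)
    show "norm (T (i + Suc k) * s (i + Suc k)) \<le> T k * (1/8) ^ Suc i" for i
      using order_trans[OF absle geo[of "Suc i"]] by simp
  qed (use g sums_summable in blast)
  then have t: "\<bar>\<Sum>i. T (i + Suc k) * s (i + Suc k)\<bar> \<le> T k / 7"
    using sums_unique[OF g] by simp
  have "(\<Sum>j. T j * s j) = (\<Sum>i. T (i + Suc k) * s (i + Suc k)) + ((\<Sum>j<k. T j * s j) + T k * s k)"
    using suminf_split_initial_segment[OF sm, of "Suc k"] by simp
  moreover have "\<bar>T k * s k\<bar> = T k * \<bar>s k\<bar>" using T by (simp add: abs_mult)
  ultimately show ?thesis using h t by (simp add: algebra_simps)
qed

text \<open>Here \<open>2 * y\<close> stands for \<open>a * L\<close> with \<open>a\<close> the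
  frequency of the chosen term and \<open>L = 1 + x\<close>. Passing from frequency \<open>b\<close>
  to \<open>2 * b\<close> multiplies the amplitude of the \<open>n\<close>-th time derivative by
  \<open>4 ^ n * exp (- b * L)\<close>. For \<open>n\<close> near \<open>y\<close>, the inequalities
  \<open>exp 1 < 4 < exp 2\<close> make this factor large when \<open>b * L \<le> y\<close> and
  small when \<open>b * L \<ge> 2 * y\<close>. The last condition sets
  \<open>n! \<le> n ^ n\<close>, about \<open>y ^ y\<close>, against an amplitude of order
  \<open>y ^ (2 * y)\<close>, up to geometric factors. The window of length 2 leaves room for two
  consecutive orders.\<close>

lemma eventually_dominance_conditions:
  assumes "C \<ge> 0" "B > 0" "L > (0::real)"
  shows "\<forall>\<^sub>F y in at_top. \<forall>n. y \<le> real n \<and> real n \<le> y + 2 \<longrightarrow>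
     8 * exp y \<le> 4 ^ n \<and> 8 * 4 ^ n \<le> exp (2 * y) \<and>
     C * fact n * B ^ n < 3/14 * (exp (- (2 * y)) * (2 * (2 * y / L)\<^sup>2) ^ n)"
proof -
  define c :: real where "c = ln 4"
  have "1 \<le> ln (3::real)"
    using exp_le by (simp add: ln_ge_iff)
  then have c1: "c > 1"
    using ln_less_cancel_iff[of 3 4] unfolding c_def by linarith
  have c2: "c < 2"
    using ln_2_less_1 ln_realpow[of 2 2] by (simp add: c_def)
  have c: "4 powr y = exp (y * c)" for y by (simp add: powr_def c_def)
  have "\<forall>\<^sub>F y in at_top. 8 * exp y \<le> 4 powr (y::real)"
    unfolding c using c1 by real_asymp
  moreover have "\<forall>\<^sub>F y in at_top. 8 * 4 powr (y + 2) \<le> exp (2 * y::real)"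
    unfolding c using c1 c2 by real_asymp
  moreover have "\<forall>\<^sub>F y in at_top. exp 3 * ((y + 2) * B) \<le> 2 * (2 * y / L)\<^sup>2"
    using assms by real_asymp
  moreover have "\<forall>\<^sub>F y in at_top. C < 3/14 * exp y" by real_asymp
  moreover have "\<forall>\<^sub>F y in at_top. y > (0::real)" by (rule eventually_gt_at_top)
  ultimately show ?thesis
  proof eventually_elim
    case (elim y)
    show ?case
    proof (intro allI impI)
      fix n assume n: "y \<le> real n \<and> real n \<le> y + 2"
      have "4 powr y \<le> 4 powr real n" "4 powr real n \<le> 4 powr (y + 2)"
        using n by (auto intro!: powr_mono)
      then have 1: "8 * exp y \<le> 4 ^ n \<and> 8 * 4 ^ n \<le> exp (2 * y)"
        using elim by (simp add: powr_realpow)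
      have "C * fact n * B ^ n \<le> C * real n ^ n * B ^ n"
        using assms fact_le_power[of n, where 'a = real] by (intro mult_right_mono mult_left_mono) auto
      also have "\<dots> = C * (real n * B) ^ n" by (simp add: power_mult_distrib)
      also have "\<dots> \<le> C * ((y + 2) * B) ^ n"
        using n assms by (intro mult_left_mono power_mono mult_right_mono) auto
      \<comment> \<open>The constant \<open>C\<close> is absorbed by \<open>exp y\<close>, which is
        then split as \<open>exp (- (2 * y)) * exp (3 * y)\<close>: the one factor belongs to the
        amplitude, the other is at most \<open>exp 3 ^ n\<close> and moves into the base of the
        power.\<close>
      also have "\<dots> < 3/14 * exp y * ((y + 2) * B) ^ n"
        using elim assms by (intro mult_strict_right_mono zero_less_power mult_pos_pos) auto
      also have "\<dots> = 3/14 * (exp (- (2 * y)) * (exp (3 * y) * ((y + 2) * B) ^ n))"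
        by (simp add: mult_exp_exp flip: mult.assoc)
      also have "\<dots> \<le> 3/14 * (exp (- (2 * y)) * (exp (3 * real n) * ((y + 2) * B) ^ n))"
        using n elim assms by (intro mult_left_mono mult_right_mono) auto
      also have "exp (3 * real n) * ((y + 2) * B) ^ n = (exp 3 * ((y + 2) * B)) ^ n"
        by (simp add: power_mult_distrib exp_of_nat2_mult)
      also have "3/14 * (exp (- (2 * y)) * (exp 3 * ((y + 2) * B)) ^ n) \<le> 3/14 * (exp (- (2 * y)) * (2 * (2 * y / L)\<^sup>2) ^ n)"
        using elim assms by (intro mult_left_mono power_mono) auto
      finally show "8 * exp y \<le> 4 ^ n \<and> 8 * 4 ^ n \<le> exp (2 * y) \<and>
          C * fact n * B ^ n < 3/14 * (exp (- (2 * y)) * (2 * (2 * y / L)\<^sup>2) ^ n)"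
        using 1 by simp
    qed
  qed
qed

lemma u1_not_analytic:
  assumes x: "x > -1"
  shows "\<not> real_analytic_at (\<lambda>t. u1 (x, t)) t"
proof
  assume "real_analytic_at (\<lambda>t. u1 (x, t)) t"
  then obtain \<rho> C B where b: "\<rho> > 0" "C \<ge> 0" "B > 0"
    and "\<And>n t'. \<bar>t' - t\<bar> < \<rho> \<Longrightarrow> \<bar>(deriv ^^ n) (\<lambda>t. u1 (x, t)) t'\<bar> \<le> C * fact n * B ^ n"
    by (rule real_analytic_at_deriv_bound) blast
  then have up: "\<bar>(deriv ^^ n) (\<lambda>t. u1 (x, t)) t\<bar> \<le> C * fact n * B ^ n" for n
    by simp
  define a :: "nat \<Rightarrow> real" where "a = (\<lambda>j. 2 ^ Suc j)"
  define L where "L = 1 + x"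
  define T where "T = (\<lambda>n j. exp (- (a j * L)) * (2 * (a j)\<^sup>2) ^ n)"
  define s where "s = (\<lambda>n j. Im (\<i> ^ n * cis (2 * (a j)\<^sup>2 * t - a j * x)))"
  have L: "L > 0" using x by (simp add: L_def)
  have d: "(deriv ^^ n) (\<lambda>t. u1 (x, t)) t = (\<Sum>j. T n j * s n j)" for n
  proof -
    have "(deriv ^^ n) (\<lambda>t. u1 (x, t)) t = pD (replicate n False) u1 (x, t)"
      by (simp add: iterated_deriv_eq_pD)
    also have "\<dots> = (\<Sum>k. u1_term k (replicate n False) (x, t))"
      unfolding u1_eq
      by (rule pD_eq_family[where G = "\<lambda>ws p. \<Sum>k. u1_term k ws p",
            OF open_halfplane u1_family_has_derivative]) (use x in auto)
    finally show ?thesis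
      unfolding osc_time_derivs T_def s_def a_def L_def .
  qed
  obtain Y where Y: "\<And>y n. y \<ge> Y \<Longrightarrow> y \<le> real n \<Longrightarrow> real n \<le> y + 2 \<Longrightarrow>
     8 * exp y \<le> 4 ^ n \<and> 8 * 4 ^ n \<le> exp (2 * y) \<and>
     C * fact n * B ^ n < 3/14 * (exp (- (2 * y)) * (2 * (2 * y / L)\<^sup>2) ^ n)"
    using eventually_dominance_conditions[OF b(2,3) L] by (auto simp: eventually_at_top_linorder)
  obtain k where k: "Y / L < 2 ^ k"
    using real_arch_pow[of 2 "Y / L"] by auto
  \<comment> \<open>Half of \<open>a k * L\<close>, since \<open>a k = 2 ^ Suc k\<close>; term
    \<open>k\<close> dominates at orders near this value.\<close>
  define y where "y = 2 ^ k * L"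
  have y: "y \<ge> Y" "2 * y = a k * L" "2 * y / L = a k" "y > 0"
    using k L by (auto simp: y_def a_def field_simps)
  \<comment> \<open>A phase of size at least \<open>1/2\<close> would leave
    \<open>1/2 - 2/7 = 3/14\<close> of the amplitude of term \<open>k\<close>, more than the Cauchy
    bound allows.\<close>
  have dom: "\<bar>s n k\<bar> < 1/2" if n: "y \<le> real n" "real n \<le> y + 2" for n
  proof (rule ccontr)
    assume ns: "\<not> \<bar>s n k\<bar> < 1/2"
    note Yn = Y[OF y(1) n]
    have rec: "T n (Suc j) = T n j * (exp (- (a j * L)) * 4 ^ n)" for j
    proof -
      have "a (Suc j) = 2 * a j" by (simp add: a_def)
      then show ?thesis
        by (simp add: T_def power_mult_distrib mult_exp_exp algebra_simps)
    qed
    have T0: "T n j \<ge> 0" for j by (simp add: T_def)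
    have amono: "a i \<le> a j" if "i \<le> j" for i j
      using that by (simp add: a_def power_increasing)
    have "T n k * (\<bar>s n k\<bar> - 2/7) \<le> \<bar>\<Sum>j. T n j * s n j\<bar>"
    proof (rule dominant_term[OF T0])
      show "\<bar>s n j\<bar> \<le> 1" for j
        unfolding s_def by (rule order_trans[OF abs_Im_le_cmod]) (simp add: norm_mult norm_power)
      show "8 * T n j \<le> T n (Suc j)" if "j < k" for j
      proof -
        have "a j * L \<le> y"
          using amono[of "Suc j" k] that L y(2) by (simp add: a_def)
        then have "8 * exp (a j * L) \<le> 4 ^ n" using Yn by (smt (verit) exp_le_cancel_iff)
        then have "8 \<le> exp (- (a j * L)) * 4 ^ n" by (simp add: exp_minus field_simps)
        from mult_left_mono[OF this T0, of j] show ?thesis by (simp only: rec mult.commute)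
      qed
      show "8 * T n (Suc j) \<le> T n j" if "k \<le> j" for j
      proof -
        have "2 * y \<le> a j * L"
          using amono[OF that] L y(2) by simp
        then have "8 * 4 ^ n \<le> exp (a j * L)" using Yn by (smt (verit) exp_le_cancel_iff)
        then have "8 * (exp (- (a j * L)) * 4 ^ n) \<le> 1" by (simp add: exp_minus field_simps)
        from mult_left_mono[OF this T0, of j] show ?thesis by (simp add: rec mult_ac)
      qed
    qed
    moreover have "T n k * (3/14) \<le> T n k * (\<bar>s n k\<bar> - 2/7)"
      using ns T0 by (intro mult_left_mono) auto
    moreover have "C * fact n * B ^ n < 3/14 * T n k"
      using Yn y by (simp add: T_def)
    ultimately show False using up[of n] d[of n] by simp
  qed
  define n where "n = nat \<lceil>y\<rceil>"
  have "y \<le> real n" "real n \<le> y + 1"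
    using y(4) of_nat_ceiling[of y] of_nat_int_ceiling[of y] ceiling_correct[of y] by (auto simp: n_def)
  then have 1: "\<bar>s n k\<bar> < 1/2" "\<bar>s (Suc n) k\<bar> < 1/2" using dom[of n] dom[of "Suc n"] by auto
  \<comment> \<open>One further time derivative multiplies \<open>z\<close> by \<open>\<i>\<close>,
    so the two consecutive phases are the imaginary and the real part of the same unit number; they
    cannot both be below \<open>1/2\<close> in modulus.\<close>
  define z where "z = \<i> ^ n * cis (2 * (a k)\<^sup>2 * t - a k * x)"
  have "norm z = 1" by (simp add: z_def norm_mult norm_power)
  moreover have "s n k = Im z" "s (Suc n) k = Re z"
    by (simp_all add: s_def z_def mult.assoc)
  ultimately show False
    using 1 cmod_le[of z] by simp
qed

section \<open>Derivatives of the heat kernel\<close>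

text \<open>The span of the functions \<open>x ^ m * t powr (- n - 1/2) * exp (- x\<^sup>2 / (4 t))\<close>, extended by 0 to \<open>t \<le> 0\<close>, contains
  the heat kernel and is closed under both partial derivatives; a triple \<open>(c, m, n)\<close> below encodes \<open>c\<close> times such a function.\<close>
definition heat_gauss :: "nat \<Rightarrow> real \<Rightarrow> real \<Rightarrow> real" where
  "heat_gauss n x t = exp (- (x\<^sup>2) / (4 * t) - (real n + 1/2) * ln t)"

definition heat_mono :: "nat \<Rightarrow> nat \<Rightarrow> real \<times> real \<Rightarrow> real" where
  "heat_mono m n p = (if snd p > 0 then fst p ^ m * heat_gauss n (fst p) (snd p) else 0)"

lemma heat_gauss_Suc: "t > 0 \<Longrightarrow> heat_gauss (Suc n) x t = heat_gauss n x t / t"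
proof -
  assume t: "t > 0"
  have "- (x\<^sup>2) / (4 * t) - (real (Suc n) + 1/2) * ln t = (- (x\<^sup>2) / (4 * t) - (real n + 1/2) * ln t) - ln t"
    by (simp add: algebra_simps)
  with t show ?thesis
    unfolding heat_gauss_def by (simp only: exp_diff exp_ln)
qed

lemma heat_mono_has_derivative_pos:
  assumes "snd p > 0"
  shows "(heat_mono m n has_derivative
     (\<lambda>h. (real m * heat_mono (m - 1) n p - heat_mono (m + 1) (n + 1) p / 2) * fst h
        + (heat_mono (m + 2) (n + 2) p / 4 - (real n + 1/2) * heat_mono m (n + 1) p) * snd h)) (at p)"
proof -
  obtain x t where p: "p = (x, t)" by (cases p)
  have t: "t > 0" using assms p by simp
  have "((\<lambda>q. - ((fst q)\<^sup>2) / (4 * snd q) - (real n + 1/2) * ln (snd q)) has_derivative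
     (\<lambda>h. - (x / (2 * t)) * fst h + (x\<^sup>2 / (4 * t\<^sup>2) - (real n + 1/2) / t) * snd h)) (at p)"
    unfolding p using t
    by (auto intro!: derivative_eq_intros simp: fun_eq_iff field_simps power2_eq_square)
  from has_derivative_compose[OF this DERIV_exp[unfolded has_field_derivative_def]]
  have "((\<lambda>q. heat_gauss n (fst q) (snd q)) has_derivative
     (\<lambda>h. heat_gauss n x t * (- (x / (2 * t)) * fst h + (x\<^sup>2 / (4 * t\<^sup>2) - (real n + 1/2) / t) * snd h))) (at p)"
    unfolding heat_gauss_def p by simp
  then have "((\<lambda>q. fst q ^ m * heat_gauss n (fst q) (snd q)) has_derivative
     (\<lambda>h. x ^ m * (heat_gauss n x t * (- (x / (2 * t)) * fst h + (x\<^sup>2 / (4 * t\<^sup>2) - (real n + 1/2) / t) * snd h))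
        + (real m * fst h * x ^ (m - 1)) * heat_gauss n x t)) (at p)"
    unfolding p by (auto intro!: derivative_eq_intros)
  moreover have "(\<lambda>h. x ^ m * (heat_gauss n x t * (- (x / (2 * t)) * fst h + (x\<^sup>2 / (4 * t\<^sup>2) - (real n + 1/2) / t) * snd h))
        + (real m * fst h * x ^ (m - 1)) * heat_gauss n x t)
     = (\<lambda>h. (real m * heat_mono (m - 1) n p - heat_mono (m + 1) (n + 1) p / 2) * fst h
        + (heat_mono (m + 2) (n + 2) p / 4 - (real n + 1/2) * heat_mono m (n + 1) p) * snd h)"
    using t by (simp add: heat_mono_def p heat_gauss_Suc fun_eq_iff power2_eq_square power_add add_divide_distrib diff_divide_distrib algebra_simps)
  ultimately have *: "((\<lambda>q. fst q ^ m * heat_gauss n (fst q) (snd q)) has_derivative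
     (\<lambda>h. (real m * heat_mono (m - 1) n p - heat_mono (m + 1) (n + 1) p / 2) * fst h
        + (heat_mono (m + 2) (n + 2) p / 4 - (real n + 1/2) * heat_mono m (n + 1) p) * snd h)) (at p)"
    by simp
  have "open {q::real\<times>real. snd q > 0}" by (intro open_Collect_less continuous_intros)
  then show ?thesis
    by (rule has_derivative_transform_within_open[OF *]) (use assms in \<open>auto simp: heat_mono_def\<close>)
qed

text \<open>In terms of \<open>y = 1 / t\<close>, the decay \<open>exp (- c * y)\<close> has to beat
  \<open>y\<close> to the power \<open>n + 1/2\<close>; \<open>c\<close> is positive because
  \<open>x\<close> stays away from 0. The half-integer power is at most
  \<open>1 + y ^ (n + 1)\<close>, where the 1 covers \<open>y \<le> 1\<close>, that is, late
  times.\<close>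

lemma heat_gauss_bounded:
  assumes d: "d > 0"
  obtains K where "K \<ge> 0" "\<And>x t. d \<le> x \<Longrightarrow> t > 0 \<Longrightarrow> heat_gauss n x t \<le> K"
proof
  define c where "c = d\<^sup>2 / 4"
  have c: "c > 0" using d by (simp add: c_def)
  define K where "K = 1 + fact (n + 1) / c ^ (n + 1)"
  show "K \<ge> 0" using c by (simp add: K_def)
  fix x t :: real assume x: "d \<le> x" and t: "t > 0"
  define y where "y = 1 / t"
  have y: "y > 0" "ln y = - ln t" using t by (auto simp: y_def ln_div)
  have "c * y \<le> x\<^sup>2 / (4 * t)"
    using x d t by (auto simp: c_def y_def divide_right_mono power_mono)
  then have "heat_gauss n x t \<le> exp (- (c * y) + (real n + 1/2) * ln y)"
    unfolding heat_gauss_def y(2) by simp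
  also have "\<dots> \<le> exp (- (c * y)) * (1 + y ^ (n + 1))"
  proof -
    have "exp ((real n + 1/2) * ln y) \<le> 1 + y ^ (n + 1)"
    proof (cases "y \<le> 1")
      case True
      then have "ln y \<le> 0" using y(1) by simp
      then have "(real n + 1/2) * ln y \<le> 0"
        by (intro mult_nonneg_nonpos) auto
      then have "exp ((real n + 1/2) * ln y) \<le> 1" by simp
      then show ?thesis using y by (smt (verit) zero_le_power)
    next
      case False
      then have "(real n + 1/2) * ln y \<le> real (n + 1) * ln y"
        using y(1) by (intro mult_right_mono) auto
      then have "exp ((real n + 1/2) * ln y) \<le> exp (real (n + 1) * ln y)" by simp
      also have "\<dots> = y ^ (n + 1)" using y(1) by (simp only: exp_of_nat_mult exp_ln)
      finally show ?thesis by simp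
    qed
    then show ?thesis by (simp only: exp_add) (intro mult_left_mono, auto)
  qed
  also have "\<dots> \<le> K"
  proof -
    have "(c * y) ^ (n + 1) \<le> fact (n + 1) * exp (c * y)"
      by (rule power_le_fact_exp) (use c y in simp)
    moreover have "c ^ (n + 1) > 0" using c by simp
    ultimately have "y ^ (n + 1) \<le> fact (n + 1) * exp (c * y) / c ^ (n + 1)"
      by (simp only: pos_le_divide_eq power_mult_distrib mult.commute)
    then have "exp (- (c * y)) * y ^ (n + 1) \<le> exp (- (c * y)) * (fact (n + 1) * exp (c * y) / c ^ (n + 1))"
      by (intro mult_left_mono) auto
    also have "\<dots> = (exp (- (c * y)) * exp (c * y)) * (fact (n + 1) / c ^ (n + 1))"
      by simp
    also have "exp (- (c * y)) * exp (c * y) = 1" by (simp add: mult_exp_exp)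
    finally have "exp (- (c * y)) * y ^ (n + 1) \<le> fact (n + 1) / c ^ (n + 1)" by simp
    moreover have "exp (- (c * y)) \<le> 1" using c y by simp
    ultimately show ?thesis by (simp only: K_def distrib_left mult_1_right)
  qed
  finally show "heat_gauss n x t \<le> K" .
qed

text \<open>The bound is uniform in time because the starting times will fill the line densely; the
  upper limit \<open>M\<close> on \<open>x\<close> controls the factor \<open>x ^ m\<close>.\<close>

lemma heat_mono_bounded:
  assumes d: "d > 0"
  shows "\<exists>K\<ge>0. \<forall>p. d \<le> fst p \<and> fst p \<le> M \<longrightarrow> \<bar>heat_mono m n p\<bar> \<le> K"
proof -
  obtain K where K: "K \<ge> 0" "\<And>x t. d \<le> x \<Longrightarrow> t > 0 \<Longrightarrow> heat_gauss n x t \<le> K"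
    using heat_gauss_bounded[OF d] by blast
  have "\<bar>heat_mono m n p\<bar> \<le> \<bar>M\<bar> ^ m * K" if "d \<le> fst p \<and> fst p \<le> M" for p
  proof (cases "snd p > 0")
    case True
    have "fst p ^ m * heat_gauss n (fst p) (snd p) \<le> \<bar>M\<bar> ^ m * K"
      using that d True K by (intro mult_mono power_mono) (auto simp: heat_gauss_def)
    moreover have "fst p ^ m * heat_gauss n (fst p) (snd p) \<ge> 0"
      using that d by (simp add: heat_gauss_def)
    ultimately show ?thesis using True by (simp add: heat_mono_def)
  qed (use K in \<open>simp add: heat_mono_def\<close>)
  then show ?thesis using K by (intro exI[of _ "\<bar>M\<bar> ^ m * K"]) auto
qed

lemma has_derivative_zero_if_quadratic:
  fixes f :: "'a::real_normed_vector \<Rightarrow> real"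
  assumes "f p = 0" and ev: "\<forall>\<^sub>F q in at p. \<bar>f q\<bar> \<le> K * (norm (q - p))\<^sup>2"
  shows "(f has_derivative (\<lambda>_. 0)) (at p)"
proof -
  have "((\<lambda>q. norm (f q - f p - 0) / norm (q - p)) \<longlongrightarrow> 0) (at p)"
  proof (rule Lim_null_comparison)
    show "\<forall>\<^sub>F q in at p. norm (norm (f q - f p - 0) / norm (q - p)) \<le> K * norm (q - p)"
      by (rule eventually_mono[OF ev]) (use assms(1) in \<open>auto simp: divide_le_eq power2_eq_square\<close>)
    show "((\<lambda>q. K * norm (q - p)) \<longlongrightarrow> 0) (at p)"
      by (auto intro!: tendsto_eq_intros)
  qed
  then show ?thesis by (simp add: has_derivative_iff_norm)
qed

text \<open>This glues in the extension by 0. Raising \<open>n\<close> by 2 divides by the square of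
  the time, so the function is that square times a bounded one, and a positive time is at most the
  distance to \<open>p\<close>, which lies at time 0 or earlier.\<close>

lemma heat_mono_has_derivative_nonpos:
  assumes "fst p > 0" "snd p \<le> 0"
  shows "(heat_mono m n has_derivative (\<lambda>_. 0)) (at p)"
proof -
  define d where "d = fst p / 2"
  have d: "d > 0" "d < fst p" using assms by (auto simp: d_def)
  obtain K where K: "K \<ge> 0" "\<And>q. d \<le> fst q \<Longrightarrow> fst q \<le> fst p + 1 \<Longrightarrow> \<bar>heat_mono m (n + 2) q\<bar> \<le> K"
    using heat_mono_bounded[OF d(1)] by meson
  have "open {q::real\<times>real. d < fst q \<and> fst q < fst p + 1}"
    by (intro open_Collect_conj open_Collect_less continuous_intros)
  then have "\<forall>\<^sub>F q in at p. d < fst q \<and> fst q < fst p + 1"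
    using eventually_at_in_open'[of _ p] d by fastforce
  then have "\<forall>\<^sub>F q in at p. \<bar>heat_mono m n q\<bar> \<le> K * (norm (q - p))\<^sup>2"
  proof eventually_elim
    case (elim q)
    show ?case
    proof (cases "snd q > 0")
      case True
      have "heat_mono m n q = heat_mono m (n + 2) q * (snd q)\<^sup>2"
        using True by (simp add: heat_mono_def heat_gauss_Suc power2_eq_square)
      moreover have "snd q \<le> norm (q - p)"
        using True assms norm_snd_le[of "snd q - snd p" "fst q - fst p"]
        by (simp add: minus_prod_def)
      then have "(snd q)\<^sup>2 \<le> (norm (q - p))\<^sup>2"
        using True by (intro power_mono) auto
      ultimately show ?thesis
        using K(2)[of q] K(1) elim by (auto simp: abs_mult intro!: mult_mono)
    qed (use K in \<open>simp add: heat_mono_def\<close>)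
  qed
  then show ?thesis
    by (intro has_derivative_zero_if_quadratic) (use assms in \<open>auto simp: heat_mono_def\<close>)
qed

lemma heat_mono_has_derivative:
  assumes "fst p > 0"
  shows "(heat_mono m n has_derivative
     (\<lambda>h. (real m * heat_mono (m - 1) n p - heat_mono (m + 1) (n + 1) p / 2) * fst h
        + (heat_mono (m + 2) (n + 2) p / 4 - (real n + 1/2) * heat_mono m (n + 1) p) * snd h)) (at p)"
proof (cases "snd p > 0")
  case False
  then show ?thesis
    using heat_mono_has_derivative_nonpos[of p m n] assms by (simp add: heat_mono_def)
qed (rule heat_mono_has_derivative_pos)

section \<open>Linear combinations of the basic functions, and all derivatives of the kernel\<close>

definition heat_comb :: "(real \<times> nat \<times> nat) list \<Rightarrow> real \<times> real \<Rightarrow> real" where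
  "heat_comb L p = (\<Sum>(c, m, n)\<leftarrow>L. c * heat_mono m n p)"

text \<open>At \<open>m = 0\<close> the truncated \<open>m - 1\<close> does no harm: its coefficient
  \<open>c * real m\<close> vanishes.\<close>

definition comb_dx :: "(real \<times> nat \<times> nat) list \<Rightarrow> (real \<times> nat \<times> nat) list" where
  "comb_dx L = concat (map (\<lambda>(c, m, n). [(c * real m, m - 1, n), (- c / 2, m + 1, n + 1)]) L)"

definition comb_dt :: "(real \<times> nat \<times> nat) list \<Rightarrow> (real \<times> nat \<times> nat) list" where
  "comb_dt L = concat (map (\<lambda>(c, m, n). [(c / 4, m + 2, n + 2), (- c * (real n + 1/2), m, n + 1)]) L)"

lemma heat_comb_has_derivative:
  assumes "fst p > 0"
  shows "(heat_comb L has_derivative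
     (\<lambda>h. heat_comb (comb_dx L) p * fst h + heat_comb (comb_dt L) p * snd h)) (at p)"
proof (induction L)
  case Nil
  show ?case by (simp add: heat_comb_def[abs_def] comb_dx_def comb_dt_def)
next
  case (Cons a L)
  obtain c m n where a: "a = (c, m, n)" by (cases a)
  have "((\<lambda>q. c * heat_mono m n q + heat_comb L q) has_derivative
     (\<lambda>h. c * ((real m * heat_mono (m - 1) n p - heat_mono (m + 1) (n + 1) p / 2) * fst h
        + (heat_mono (m + 2) (n + 2) p / 4 - (real n + 1/2) * heat_mono m (n + 1) p) * snd h)
        + (heat_comb (comb_dx L) p * fst h + heat_comb (comb_dt L) p * snd h))) (at p)"
    by (intro has_derivative_add has_derivative_mult_right heat_mono_has_derivative Cons assms)
  moreover have "(\<lambda>q. c * heat_mono m n q + heat_comb L q) = heat_comb (a # L)"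
    by (simp add: heat_comb_def a fun_eq_iff)
  moreover have "(\<lambda>h. c * ((real m * heat_mono (m - 1) n p - heat_mono (m + 1) (n + 1) p / 2) * fst h
        + (heat_mono (m + 2) (n + 2) p / 4 - (real n + 1/2) * heat_mono m (n + 1) p) * snd h)
        + (heat_comb (comb_dx L) p * fst h + heat_comb (comb_dt L) p * snd h))
     = (\<lambda>h. heat_comb (comb_dx (a # L)) p * fst h + heat_comb (comb_dt (a # L)) p * snd h)"
    by (simp add: heat_comb_def comb_dx_def comb_dt_def a fun_eq_iff algebra_simps)
  ultimately show ?case by simp
qed

lemma heat_comb_bounded:
  assumes d: "d > 0"
  shows "\<exists>K\<ge>0. \<forall>p. d \<le> fst p \<and> fst p \<le> M \<longrightarrow> \<bar>heat_comb L p\<bar> \<le> K"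
proof (induction L)
  case (Cons a L)
  obtain c m n where a: "a = (c, m, n)" by (cases a)
  obtain K where K: "K \<ge> 0" "\<And>p. d \<le> fst p \<and> fst p \<le> M \<Longrightarrow> \<bar>heat_comb L p\<bar> \<le> K"
    using Cons by auto
  obtain K' where K': "K' \<ge> 0" "\<And>p. d \<le> fst p \<and> fst p \<le> M \<Longrightarrow> \<bar>heat_mono m n p\<bar> \<le> K'"
    using heat_mono_bounded[OF d] by meson
  have "\<bar>heat_comb (a # L) p\<bar> \<le> \<bar>c\<bar> * K' + K" if "d \<le> fst p \<and> fst p \<le> M" for p
  proof -
    have "\<bar>heat_comb (a # L) p\<bar> \<le> \<bar>c\<bar> * \<bar>heat_mono m n p\<bar> + \<bar>heat_comb L p\<bar>"
      by (simp add: heat_comb_def a flip: abs_mult)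
    also have "\<dots> \<le> \<bar>c\<bar> * K' + K"
      using K(2)[OF that] K'(2)[OF that] by (intro add_mono mult_left_mono) auto
    finally show ?thesis .
  qed
  then show ?case using K K' by (intro exI[of _ "\<bar>c\<bar> * K' + K"]) auto
qed (auto simp: heat_comb_def)

fun heat_word :: "bool list \<Rightarrow> (real \<times> nat \<times> nat) list" where
  "heat_word [] = [((4 * pi) powr (-1/2), 0, 0)]"
| "heat_word (b # ws) = (if b then comb_dx (heat_word ws) else comb_dt (heat_word ws))"

definition heat_kernel_deriv :: "bool list \<Rightarrow> real \<times> real \<Rightarrow> real" where
  "heat_kernel_deriv ws = heat_comb (heat_word ws)"

lemma heat_kernel_deriv_Nil: "heat_kernel_deriv [] (x, t) = heat_kernel x t"
proof (cases "t > 0")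
  case True
  have "exp (- (x\<^sup>2) / (4 * t) - (real 0 + 1/2) * ln t) = exp (- (x\<^sup>2) / (4 * t)) * t powr (-1/2)"
    using True by (simp add: powr_def mult_exp_exp)
  then show ?thesis using True
    by (simp add: heat_kernel_deriv_def heat_comb_def heat_mono_def heat_gauss_def heat_kernel_def powr_mult)
qed (simp add: heat_kernel_deriv_def heat_comb_def heat_mono_def heat_kernel_def)

lemma heat_kernel_deriv_has_derivative:
  assumes "fst p > 0"
  shows "(heat_kernel_deriv ws has_derivative
     (\<lambda>h. heat_kernel_deriv (True # ws) p * fst h + heat_kernel_deriv (False # ws) p * snd h)) (at p)"
  using heat_comb_has_derivative[OF assms] by (simp add: heat_kernel_deriv_def)

text \<open>Both words produce the same triples, up to order and triples with coefficient 0, so the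
  two sides agree at every \<open>p\<close>, also across the starting time.\<close>

lemma heat_kernel_deriv_heat:
  "heat_kernel_deriv [False] p = heat_kernel_deriv [True, True] p"
  by (simp add: heat_kernel_deriv_def heat_comb_def comb_dx_def comb_dt_def numeral_2_eq_2)

lemma heat_kernel_deriv_nonpos: "t \<le> 0 \<Longrightarrow> heat_kernel_deriv ws (x, t) = 0"
proof -
  assume t: "t \<le> 0"
  have "heat_comb L (x, t) = 0" for L
    by (induction L) (use t in \<open>auto simp: heat_comb_def heat_mono_def\<close>)
  then show ?thesis by (simp add: heat_kernel_deriv_def)
qed

lemma heat_kernel_deriv_bounded:
  assumes "d > 0"
  obtains K where "K \<ge> 0" "\<And>p. d \<le> fst p \<Longrightarrow> fst p \<le> M \<Longrightarrow> \<bar>heat_kernel_deriv ws p\<bar> \<le> K"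
  using heat_comb_bounded[OF assms, of M "heat_word ws"] unfolding heat_kernel_deriv_def by blast

lemma heat_kernel_time_derivs:
  assumes "x > 0"
  shows "((\<lambda>t. heat_kernel_deriv (replicate n False) (x, t)) has_real_derivative
           heat_kernel_deriv (replicate (Suc n) False) (x, t)) (at t)"
  using partial_derivs_from_has_derivative(2)[OF heat_kernel_deriv_has_derivative[of "(x, t)" "replicate n False"]] assms
  by simp

text \<open>At fixed \<open>x\<close> the kernel extends to the right half-plane as
  \<open>g\<close>, with the root taken through \<open>Ln\<close>. On \<open>Re z \<ge> d/2\<close>,
  positivity of \<open>Re (1/z)\<close> bounds the Gaussian factor by 1 and
  \<open>norm z \<ge> d/2\<close> bounds the root. Discs of radius \<open>d/2\<close> about
  \<open>t \<ge> d\<close> stay in that region, so Cauchy's inequality is uniform in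
  \<open>t\<close>.\<close>

lemma heat_kernel_time_derivs_tail:
  assumes x: "x > 0" and d: "d > 0"
  shows "\<exists>C B. C \<ge> 0 \<and> B > 0 \<and>
    (\<forall>n t. t \<ge> d \<longrightarrow> \<bar>heat_kernel_deriv (replicate n False) (x, t)\<bar> \<le> C * fact n * B ^ n)"
proof -
  define g where "g = (\<lambda>z. exp (- (Ln (of_real (4 * pi) * z)) / 2 - of_real (x\<^sup>2) / (4 * z)))"
  have it: "(deriv ^^ n) (\<lambda>t. heat_kernel_deriv [] (x, t)) = (\<lambda>t. heat_kernel_deriv (replicate n False) (x, t))" for n
  proof (induction n)
    case (Suc n)
    then show ?case using DERIV_imp_deriv[OF heat_kernel_time_derivs[OF x, of n]]
      by (simp only: funpow.simps o_apply)
  qed simp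
  have hol: "g holomorphic_on {z. Re z > 0}"
    unfolding g_def
  proof (intro holomorphic_intros)
    fix z assume "z \<in> {z. Re z > 0}"
    then show "of_real (4 * pi) * z \<notin> \<real>\<^sub>\<le>\<^sub>0"
      using pi_gt_zero by (auto simp: complex_nonpos_Reals_iff mult_le_0_iff simp del: pi_gt_zero)
  qed auto
  have op: "open {z. Re z > 0}" by (rule open_halfspace_Re_gt)
  have der: "heat_kernel_deriv (replicate n False) (x, t) = Re ((deriv ^^ n) g (of_real t))" if "t > 0" for n t
    unfolding it[of n, symmetric, THEN fun_cong]
  proof (rule iterated_deriv_Re[OF op hol, of "{0<..}"])
    show "heat_kernel_deriv [] (x, t) = Re (g (of_real t))" if "t \<in> {0<..}" for t
    proof -
      have t: "t > 0" using that by simp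
      have "Ln (of_real (4 * pi) * of_real t) = of_real (ln (4 * pi * t))"
        using t by (simp add: Ln_of_real flip: of_real_mult)
      then have "g (of_real t) = exp (of_real (- ln (4 * pi * t) / 2 - x\<^sup>2 / (4 * t)))"
        by (simp add: g_def)
      then have "Re (g (of_real t)) = exp (- ln (4 * pi * t) / 2 - x\<^sup>2 / (4 * t))"
        by (simp only: exp_of_real Re_complex_of_real)
      then show ?thesis
        using t by (simp add: heat_kernel_deriv_Nil heat_kernel_def powr_def mult_exp_exp)
    qed
  qed (use that in auto)
  define C where "C = exp (- ln (4 * pi * (d/2)) / 2)"
  have gC: "norm (g z) \<le> C" if z: "Re z \<ge> d/2" for z
  proof -
    have z0: "Re z > 0" "z \<noteq> 0" using z d by auto
    have "Re (of_real (x\<^sup>2) / (4 * z)) \<ge> 0"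
    proof -
      have "of_real (x\<^sup>2) / (4 * z) = of_real (x\<^sup>2 / 4) * inverse z" by (simp add: field_simps)
      also have "Re \<dots> = x\<^sup>2 / 4 * Re (inverse z)" by simp
      also have "\<dots> \<ge> 0" using z0 by (intro mult_nonneg_nonneg) auto
      finally show ?thesis .
    qed
    moreover have "ln (4 * pi * (d/2)) \<le> Re (Ln (of_real (4 * pi) * z))"
    proof -
      have "d / 2 \<le> norm z" using z complex_Re_le_cmod[of z] by linarith
      then have "4 * pi * (d/2) \<le> norm (of_real (4 * pi) * z)" by (simp add: norm_mult)
      moreover have "Re (Ln (of_real (4 * pi) * z)) = ln (norm (of_real (4 * pi) * z))"
        using z0 by (intro Re_Ln) auto
      moreover have "4 * pi * (d/2) > 0" using d by simp
      ultimately show ?thesis by (metis ln_le_cancel_iff order_less_le_trans)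
    qed
    ultimately show ?thesis unfolding g_def C_def by simp
  qed
  have "\<bar>heat_kernel_deriv (replicate n False) (x, t)\<bar> \<le> C * fact n * (2/d) ^ n" if t: "t \<ge> d" for n t
  proof -
    have re: "Re z \<ge> d/2" if "z \<in> cball (of_real t) (d/2)" for z
      using that t abs_Re_le_cmod[of "of_real t - z"] by (simp add: dist_complex_def)
    then have sub: "cball (of_real t) (d/2) \<subseteq> {z. Re z > 0}" using d by force
    have "norm ((deriv ^^ n) g (of_real t)) \<le> fact n * C / (d/2) ^ n"
    proof (rule Cauchy_inequality)
      show "g holomorphic_on ball (of_real t) (d/2)"
        using hol sub ball_subset_cball holomorphic_on_subset by (metis subset_trans)
      show "continuous_on (cball (of_real t) (d/2)) g"
        using hol sub continuous_on_subset holomorphic_on_imp_continuous_on by metis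
      show "norm (g z) \<le> C" if "norm (of_real t - z) = d/2" for z
        using that by (intro gC re) (simp add: dist_complex_def)
    qed (use d in auto)
    then have "\<bar>Re ((deriv ^^ n) g (of_real t))\<bar> \<le> fact n * C / (d/2) ^ n"
      using abs_Re_le_cmod order_trans by blast
    then show ?thesis using t d by (simp add: der power_divide field_simps)
  qed
  then show ?thesis using d by (intro exI[of _ C] exI[of _ "2/d"]) (auto simp: C_def)
qed

text \<open>Serves both examples. Local domination on x > -1 permits termwise differentiation, while
  the single majorant \<open>M\<close> on x > 0 gives the essential bound. The smooth extension
  required on the closed half-plane is \<open>u\<close> itself, taken on x > -1.\<close>

lemma heat_series:
  fixes F :: "nat \<Rightarrow> bool list \<Rightarrow> real \<times> real \<Rightarrow> real"
  defines "u \<equiv> \<lambda>p. \<Sum>k. F k [] p"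
  assumes der: "\<And>k ws p. fst p > -1 \<Longrightarrow>
      (F k ws has_derivative (\<lambda>h. F k (True # ws) p * fst h + F k (False # ws) p * snd h)) (at p)"
    and bd: "\<And>ws p. fst p > -1 \<Longrightarrow>
      \<exists>V M. open V \<and> p \<in> V \<and> summable M \<and> (\<forall>k. \<forall>q\<in>V. \<bar>F k ws q\<bar> \<le> M k)"
    and heat: "\<And>k p. F k [False] p = F k [True, True] p"
    and M: "summable M" "\<And>k p. fst p > 0 \<Longrightarrow> \<bar>F k [] p\<bar> \<le> M k"
  shows "smooth_on_closed Omega1_closure u" "smooth_heat_on_closed Omega1_closure u"
    and "Linf_on Omega1 u"
    and "x > -1 \<Longrightarrow> (deriv ^^ n) (\<lambda>t. u (x, t)) t = (\<Sum>k. F k (replicate n False) (x, t))"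
proof -
  let ?U = "{p::real\<times>real. fst p > -1}"
  define G where "G = (\<lambda>ws p. \<Sum>k. F k ws p)"
  have u: "u = G []" by (simp add: u_def G_def)
  have derG: "(G ws has_derivative (\<lambda>h. G (True # ws) p * fst h + G (False # ws) p * snd h)) (at p)"
    if "p \<in> ?U" for ws p
    unfolding G_def by (rule series_family_has_derivative[OF open_halfplane der bd that]) auto
  have pD: "pD ws (G []) p = G ws p" if "p \<in> ?U" for ws p
    by (rule pD_eq_family[OF open_halfplane derG that])
  have C: "C_inf_on ?U u"
    unfolding u by (rule C_inf_on_family[where U = ?U, OF open_halfplane derG])
  have sub: "Omega1_closure \<subseteq> ?U" by (auto simp: Omega1_closure_def)
  have eq: "pt u p - px (px u) p = 0" if "p \<in> ?U" for p
  proof -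
    have "pt u p = G [False] p" "px (px u) p = G [True, True] p"
      using pD[OF that, of "[False]"] pD[OF that, of "[True, True]"] by (simp_all add: u)
    then show ?thesis by (simp add: G_def heat)
  qed
  show "smooth_on_closed Omega1_closure u"
    unfolding smooth_on_closed_def using C sub open_halfplane by blast
  show "smooth_heat_on_closed Omega1_closure u"
    unfolding smooth_heat_on_closed_def using C sub open_halfplane eq by blast
  show "(deriv ^^ n) (\<lambda>t. u (x, t)) t = (\<Sum>k. F k (replicate n False) (x, t))" if "x > -1"
  proof -
    have "(deriv ^^ n) (\<lambda>t. u (x, t)) t = pD (replicate n False) (G []) (x, t)"
      unfolding u by (rule iterated_deriv_eq_pD[THEN fun_cong])
    also have "\<dots> = G (replicate n False) (x, t)" by (rule pD) (use that in simp)
    finally show ?thesis by (simp only: G_def)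
  qed
  show "Linf_on Omega1 u"
    unfolding Linf_on_def
  proof
    have "continuous_on Omega1 u"
      using derG[of _ "[]"] has_derivative_continuous u
      by (intro continuous_at_imp_continuous_on) (force simp: Omega1_def)
    moreover have "Omega1 \<in> sets borel"
      using open_halfplane[of 0] by (simp add: Omega1_def)
    ultimately have "(\<lambda>p. indicator Omega1 p *\<^sub>R u p) \<in> borel_measurable borel"
      by (intro borel_measurable_continuous_on_indicator)
    then have "(\<lambda>p. indicator Omega1 p *\<^sub>R u p) \<in> borel_measurable lborel"
      by simp
    then show "set_borel_measurable lebesgue Omega1 u"
      unfolding set_borel_measurable_def by (rule measurable_completion)
    have "\<bar>u p\<bar> \<le> (\<Sum>k. M k)" if "p \<in> Omega1" for p
      unfolding u_def using norm_suminf_le[OF _ M(1), of "\<lambda>k. F k [] p"] M(2)[of p] that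
      by (simp add: Omega1_def)
    then show "\<exists>B. AE p in lebesgue. p \<in> Omega1 \<longrightarrow> \<bar>u p\<bar> \<le> B" by blast
  qed
qed

section \<open>Superpositions of translates\<close>

text \<open>Write \<open>S n\<close> for the supremum of \<open>\<bar>\<psi> n\<bar>\<close> and evaluate the \<open>n\<close>-th derivative of the superposition
  at \<open>s j + \<tau>\<close>, where \<open>\<bar>\<psi> n \<tau>\<bar>\<close> is almost \<open>S n\<close>: finitely many other sources are at a
  positive distance and contribute at most geometrically (times \<open>n!\<close>), and the remaining ones have small total weight.
  Hence \<open>S n\<close> would grow at most like \<open>n! B ^ n\<close>, which is impossible for a nonzero function that is flat at 0.\<close>
lemma superposition_derivs_not_geometric:
  fixes \<psi> :: "nat \<Rightarrow> real \<Rightarrow> real" and w s :: "nat \<Rightarrow> real"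
  assumes der: "\<And>n t. (\<psi> n has_real_derivative \<psi> (Suc n) t) (at t)"
    and zero: "\<And>n t. t \<le> 0 \<Longrightarrow> \<psi> n t = 0"
    and bdd: "\<And>n. \<exists>K. \<forall>t. \<bar>\<psi> n t\<bar> \<le> K"
    and tail: "\<And>d. d > 0 \<Longrightarrow> \<exists>C B. C \<ge> 0 \<and> B > 0 \<and> (\<forall>n t. t \<ge> d \<longrightarrow> \<bar>\<psi> n t\<bar> \<le> C * fact n * B ^ n)"
    and nz: "\<And>t. t > 0 \<Longrightarrow> \<psi> 0 t \<noteq> 0"
    and w: "\<And>k. w k > 0" "summable w"
    and s: "inj s" and j: "\<bar>s j - t0\<bar> < \<rho>"
    and CB: "C \<ge> 0" "B > 0"
    and bound: "\<And>n t. \<bar>t - t0\<bar> < \<rho> \<Longrightarrow> \<bar>\<Sum>k. w k * \<psi> n (t - s k)\<bar> \<le> C * fact n * B ^ n"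
  shows False
proof -
  define S where "S = (\<lambda>n. SUP t. \<bar>\<psi> n t\<bar>)"
  have bdda: "bdd_above (range (\<lambda>t. \<bar>\<psi> n t\<bar>))" for n
    using bdd[of n] by (auto simp: bdd_above_def)
  have Sle: "\<bar>\<psi> n t\<bar> \<le> S n" for n t
    unfolding S_def by (rule cSUP_upper[OF UNIV_I bdda])
  have S0: "S n \<ge> 0" for n using Sle[of n 0] by linarith
  have near: "\<exists>t. S n / 2 \<le> \<bar>\<psi> n t\<bar>" for n
  proof (cases "S n = 0")
    case False
    then have "S n / 2 < S n" using S0[of n] by linarith
    then have "\<exists>t. S n / 2 < \<bar>\<psi> n t\<bar>"
      using less_cSUP_iff[OF UNIV_not_empty bdda, of "S n / 2" n] by (simp add: S_def)
    then show ?thesis by (meson less_imp_le)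
  qed auto
  \<comment> \<open>Sources from index \<open>N\<close> on will take at most
    \<open>w j * S n / 8\<close> away from the \<open>w j * S n / 2\<close> supplied by source
    \<open>j\<close>.\<close>
  obtain N0 where N0: "\<And>n. n \<ge> N0 \<Longrightarrow> norm (\<Sum>i. w (i + n)) < w j / 8"
    using suminf_exist_split[OF _ w(2), of "w j / 8"] w(1)[of j] by auto
  obtain N where N: "j < N" "(\<Sum>i. w (i + N)) < w j / 8"
  proof
    have "norm (\<Sum>i. w (i + max N0 (Suc j))) < w j / 8" by (rule N0) simp
    then show "(\<Sum>i. w (i + max N0 (Suc j))) < w j / 8" by simp
  qed simp
  \<comment> \<open>Inserting 1 keeps \<open>D\<close> nonempty when \<open>j\<close> is the only
    index below \<open>N\<close>.\<close>
  define D where "D = insert 1 ((\<lambda>k. \<bar>s k - s j\<bar>) ` ({..<N} - {j}))"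
  have "finite D" "D \<noteq> {}" by (auto simp: D_def)
  moreover have "\<forall>z\<in>D. z > 0" using s by (auto simp: D_def inj_eq)
  ultimately have D: "Min D > 0" "\<And>z. z \<in> D \<Longrightarrow> Min D \<le> z" by auto
  \<comment> \<open>Other sources below \<open>N\<close> are then at least \<open>2 * d\<close> away
    from \<open>s j\<close>: at time \<open>s j + \<tau>\<close> with \<open>0 < \<tau> < d\<close>,
    each of them has either not started or started at least \<open>d\<close> ago. The second entry
    keeps this time in the neighbourhood of \<open>t0\<close>.\<close>
  define d where "d = min (Min D / 2) (\<rho> - \<bar>s j - t0\<bar>)"
  have d: "d > 0" "d \<le> \<rho> - \<bar>s j - t0\<bar>" using D j by (auto simp: d_def)
  have sep: "2 * d \<le> \<bar>s k - s j\<bar>" if "k < N" "k \<noteq> j" for k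
  proof -
    have "\<bar>s k - s j\<bar> \<in> D" using that by (auto simp: D_def)
    then have "Min D \<le> \<bar>s k - s j\<bar>" by (rule D(2))
    moreover have "d \<le> Min D / 2" unfolding d_def by (rule min.cobounded1)
    ultimately show ?thesis by linarith
  qed
  obtain C1 B1 where C1: "C1 \<ge> 0" "B1 > 0" "\<And>n t. t \<ge> d \<Longrightarrow> \<bar>\<psi> n t\<bar> \<le> C1 * fact n * B1 ^ n"
    using tail[OF d(1)] by blast
  define W where "W = (\<Sum>k<N. w k)"
  have W: "W \<ge> 0" unfolding W_def by (rule sum_nonneg) (use w less_imp_le in auto)
  define B2 where "B2 = max B B1"
  \<comment> \<open>The first summand comes from dividing by
    \<open>3 * w j / 8 = w j / 2 - w j / 8\<close>, what remains of source \<open>j\<close> after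
    the far ones are absorbed; the second covers the case \<open>\<tau> \<ge> d\<close>.\<close>
  define C2 where "C2 = (C + W * C1) * 8 / (3 * w j) + 2 * C1"
  have C2: "C2 \<ge> 0" unfolding C2_def using W C1 CB w(1)[of j] by simp
  have B2: "B2 > 0" "B ^ n \<le> B2 ^ n" "B1 ^ n \<le> B2 ^ n" for n
    using CB C1 by (auto simp: B2_def intro!: power_mono)
  have growth: "S n \<le> C2 * fact n * B2 ^ n" for n
  proof -
    obtain \<tau> where \<tau>: "S n / 2 \<le> \<bar>\<psi> n \<tau>\<bar>" using near by blast
    define X where "X = (fact n * B2 ^ n :: real)"
    have X: "X \<ge> 0" using B2 by (simp add: X_def)
    have leX: "C * fact n * B ^ n \<le> C * X" "C1 * fact n * B1 ^ n \<le> C1 * X"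
      unfolding X_def mult.assoc using CB C1 B2 by (auto intro!: mult_left_mono)
    consider "\<tau> \<le> 0" | "\<tau> \<ge> d" | "0 < \<tau>" "\<tau> < d" by linarith
    then have "S n \<le> C2 * X"
    proof cases
      case 1
      then show ?thesis using \<tau> zero C2 X by (auto intro: order_trans)
    next
      case 2
      then have "S n \<le> 2 * C1 * X" using C1(3)[of \<tau> n] \<tau> leX by linarith
      also have "\<dots> \<le> C2 * X"
        unfolding C2_def using X W C1 CB w(1)[of j] by (intro mult_right_mono) auto
      finally show ?thesis .
    next
      case 3
      define t where "t = s j + \<tau>"
      have "\<bar>t - t0\<bar> < \<rho>" using 3 d j unfolding t_def by linarith
      note bt = bound[OF this, of n]
      have wabs: "\<bar>w k * \<psi> n z\<bar> \<le> w k * S n" for k z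
        using w(1)[of k] Sle by (simp add: abs_mult)
      have sm: "summable (\<lambda>k. w k * \<psi> n (t - s k))"
        by (rule summable_comparison_test'[OF summable_mult2[OF w(2), of "S n"], of 0])
           (use wabs in auto)
      have smN: "summable (\<lambda>i. w (i + N))" using w(2) summable_iff_shift[of w N] by blast
      have "norm (\<Sum>i. w (i + N) * \<psi> n (t - s (i + N))) \<le> (\<Sum>i. w (i + N) * S n)"
        by (rule norm_suminf_le[OF _ summable_mult2[OF smN]]) (use wabs in simp)
      also have "\<dots> = (\<Sum>i. w (i + N)) * S n" by (rule suminf_mult2[symmetric, OF smN])
      also have "\<dots> \<le> w j / 8 * S n" using N S0 by (intro mult_right_mono) auto
      finally have far: "\<bar>\<Sum>i. w (i + N) * \<psi> n (t - s (i + N))\<bar> \<le> w j * S n / 8" by simp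
      have "\<bar>\<Sum>k\<in>{..<N}-{j}. w k * \<psi> n (t - s k)\<bar> \<le> (\<Sum>k\<in>{..<N}-{j}. w k * (C1 * X))"
      proof (rule order_trans[OF sum_abs sum_mono])
        fix k assume k: "k \<in> {..<N} - {j}"
        have "\<bar>\<psi> n (t - s k)\<bar> \<le> C1 * X"
        proof (cases "t - s k \<le> 0")
          case True
          then show ?thesis using zero C1 X by simp
        next
          case False
          then have "t - s k \<ge> d" using sep[of k] k 3 unfolding t_def by auto
          then show ?thesis using C1(3) leX by (meson order_trans)
        qed
        then show "\<bar>w k * \<psi> n (t - s k)\<bar> \<le> w k * (C1 * X)"
          using w(1)[of k] by (simp add: abs_mult)
      qed
      also have "\<dots> \<le> (\<Sum>k<N. w k * (C1 * X))"
        by (rule sum_mono2) (use w(1) C1 X in \<open>auto intro!: mult_nonneg_nonneg less_imp_le[OF w(1)]\<close>)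
      also have "\<dots> = W * C1 * X" by (simp add: W_def sum_distrib_right mult.assoc)
      finally have nearb: "\<bar>\<Sum>k\<in>{..<N}-{j}. w k * \<psi> n (t - s k)\<bar> \<le> W * C1 * X" .
      have "(\<Sum>k. w k * \<psi> n (t - s k)) = (\<Sum>i. w (i + N) * \<psi> n (t - s (i + N)))
          + (w j * \<psi> n \<tau> + (\<Sum>k\<in>{..<N}-{j}. w k * \<psi> n (t - s k)))"
        using suminf_split_initial_segment[OF sm, of N] N
          sum.remove[of "{..<N}" j "\<lambda>k. w k * \<psi> n (t - s k)"] by (simp add: t_def)
      then have "w j * \<bar>\<psi> n \<tau>\<bar> \<le> w j * S n / 8 + W * C1 * X + C * X"
        using far nearb bt leX w(1)[of j] abs_mult[of "w j" "\<psi> n \<tau>"] by auto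
      moreover have "w j * (S n / 2) \<le> w j * \<bar>\<psi> n \<tau>\<bar>"
        using \<tau> w(1)[of j] by (intro mult_left_mono) auto
      ultimately have "S n * (3 * w j) \<le> (C + W * C1) * 8 * X"
        by (simp add: algebra_simps)
      then have "S n \<le> (C + W * C1) * 8 * X / (3 * w j)"
        using w(1)[of j] by (simp add: pos_le_divide_eq)
      also have "\<dots> = (C + W * C1) * 8 / (3 * w j) * X" by simp
      also have "\<dots> \<le> C2 * X" unfolding C2_def using C1 X by (intro mult_right_mono) auto
      finally show ?thesis .
    qed
    then show ?thesis by (simp add: X_def mult.assoc)
  qed
  \<comment> \<open>All \<open>\<psi> m\<close> vanish at 0, so the Maclaurin expansion at this
    \<open>t\<close> is its remainder alone, of size at most
    \<open>C2 * (B2 * t) ^ n = C2 / 2 ^ n\<close> for every \<open>n\<close>.\<close>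
  define t where "t = 1 / (2 * B2)"
  have t: "t > 0" "B2 * t = 1/2" using B2(1) by (auto simp: t_def)
  have small: "\<bar>\<psi> 0 t\<bar> \<le> C2 * (1/2) ^ n" for n
  proof -
    obtain \<xi> where "\<psi> 0 t = (\<Sum>m<n. \<psi> m 0 / fact m * t ^ m) + \<psi> n \<xi> / fact n * t ^ n"
      using Maclaurin_all_le[of \<psi> "\<psi> 0" t n] der by blast
    then have "\<bar>\<psi> 0 t\<bar> = \<bar>\<psi> n \<xi>\<bar> / fact n * t ^ n"
      using t zero by (simp add: abs_mult)
    also have "\<dots> \<le> (C2 * fact n * B2 ^ n) / fact n * t ^ n"
      using t order_trans[OF Sle growth] by (intro mult_right_mono divide_right_mono) auto
    also have "\<dots> = C2 * (B2 * t) ^ n" by (simp add: power_mult_distrib)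
    finally show ?thesis by (simp only: t)
  qed
  have "(\<lambda>n. C2 * (1/2) ^ n) \<longlonglongrightarrow> C2 * 0"
    by (intro tendsto_mult tendsto_const LIMSEQ_realpow_zero) auto
  then have "\<bar>\<psi> 0 t\<bar> \<le> C2 * 0"
    by (rule LIMSEQ_le_const) (use small in blast)
  then show False using nz[OF t(1)] by simp
qed

section \<open>The superposition \<open>u2\<close> of heat sources\<close>

definition u2_term :: "(nat \<Rightarrow> real) \<Rightarrow> nat \<Rightarrow> bool list \<Rightarrow> real \<times> real \<Rightarrow> real" where
  "u2_term r k ws p = (1/2) ^ Suc k * heat_kernel_deriv ws (fst p + 1, snd p - r (Suc k))"

lemma u2_eq: "u2 r = (\<lambda>p. \<Sum>k. u2_term r k [] p)"
  by (simp add: u2_def u2_term_def heat_kernel_deriv_Nil fun_eq_iff)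

lemma u2_term_has_derivative:
  assumes "fst p > -1"
  shows "(u2_term r k ws has_derivative
     (\<lambda>h. u2_term r k (True # ws) p * fst h + u2_term r k (False # ws) p * snd h)) (at p)"
proof -
  let ?g = "\<lambda>p::real\<times>real. (fst p + 1, snd p - r (Suc k))"
  have "(?g has_derivative (\<lambda>h. h)) (at p)"
    by (auto intro!: derivative_eq_intros)
  from has_derivative_compose[OF this heat_kernel_deriv_has_derivative[of "?g p" ws]] assms
  have "((\<lambda>q. heat_kernel_deriv ws (?g q)) has_derivative
     (\<lambda>h. heat_kernel_deriv (True # ws) (?g p) * fst h + heat_kernel_deriv (False # ws) (?g p) * snd h)) (at p)"
    by simp
  from has_derivative_mult_right[OF this, of "(1/2) ^ Suc k"]
  show ?thesis by (simp add: u2_term_def[abs_def] algebra_simps)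
qed

lemma summable_half_powers: "summable (\<lambda>k. (1/2) ^ Suc k * K :: real)"
  by (intro summable_mult2) (simp add: summable_geometric)

lemma u2_term_le:
  assumes "\<And>t. \<bar>heat_kernel_deriv ws (fst q + 1, t)\<bar> \<le> K"
  shows "\<bar>u2_term r k ws q\<bar> \<le> (1/2) ^ Suc k * K"
  using assms by (simp add: u2_term_def abs_mult)

lemma u2_locally_dominated:
  assumes "fst p > -1"
  shows "\<exists>V M. open V \<and> p \<in> V \<and> summable M \<and> (\<forall>k. \<forall>q\<in>V. \<bar>u2_term r k ws q\<bar> \<le> M k)"
proof -
  define d where "d = (fst p + 1) / 2"
  have d: "d > 0" "d < fst p + 1" using assms by (auto simp: d_def)
  obtain K where K: "K \<ge> 0" "\<And>q. d \<le> fst q \<Longrightarrow> fst q \<le> fst p + 2 \<Longrightarrow> \<bar>heat_kernel_deriv ws q\<bar> \<le> K"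
    using heat_kernel_deriv_bounded[OF d(1)] by metis
  let ?V = "{q::real\<times>real. d < fst q + 1 \<and> fst q < fst p + 1}"
  have "open ?V"
    by (intro open_Collect_conj open_Collect_less continuous_intros)
  moreover have "\<bar>u2_term r k ws q\<bar> \<le> (1/2) ^ Suc k * K" if "q \<in> ?V" for k q
    using that by (intro u2_term_le K) auto
  ultimately show ?thesis
    using summable_half_powers d by (intro exI[of _ ?V] exI[of _ "\<lambda>k. (1/2) ^ Suc k * K"]) auto
qed

text \<open>Essential boundedness needs a bound on the whole of x > 0, not only on strips of bounded
  width. For the kernel itself no power of \<open>x\<close> occurs, so the Gaussian bound with
  \<open>x + 1 \<ge> 1\<close> suffices.\<close>

lemma u2_term_bound:
  obtains K where "\<And>r k p. fst p > 0 \<Longrightarrow> \<bar>u2_term r k [] p\<bar> \<le> (1/2) ^ Suc k * K"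
proof -
  obtain K where K: "K \<ge> 0" "\<And>x t. 1 \<le> x \<Longrightarrow> t > 0 \<Longrightarrow> heat_gauss 0 x t \<le> K"
    using heat_gauss_bounded[of 1 0] by auto
  have "\<bar>heat_kernel_deriv [] (x, t)\<bar> \<le> (4 * pi) powr (-1/2) * K" if "1 \<le> x" for x t
    using K that by (auto simp: heat_kernel_deriv_def heat_comb_def heat_mono_def abs_mult heat_gauss_def)
  then show ?thesis
    by (intro that[of "(4 * pi) powr (-1/2) * K"] u2_term_le) auto
qed

text \<open>Density of the rationals puts a starting time within \<open>\<rho>\<close> of
  \<open>t0\<close>, and injectivity of the enumeration separates it from all the others. At fixed
  \<open>x\<close> the series superposes translates of one profile, the kernel at distance
  \<open>x + 1 > 0\<close>.\<close>

lemma u2_not_analytic: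
  assumes r: "bij_betw r {1..} \<rat>" and x: "x > -1"
    and d: "\<And>n t. (deriv ^^ n) (\<lambda>t. u2 r (x, t)) t = (\<Sum>k. u2_term r k (replicate n False) (x, t))"
  shows "\<not> real_analytic_at (\<lambda>t. u2 r (x, t)) t0"
proof
  assume "real_analytic_at (\<lambda>t. u2 r (x, t)) t0"
  then obtain \<rho> C B where b: "\<rho> > 0" "C \<ge> 0" "B > 0"
    and ub: "\<And>n t. \<bar>t - t0\<bar> < \<rho> \<Longrightarrow> \<bar>(deriv ^^ n) (\<lambda>t. u2 r (x, t)) t\<bar> \<le> C * fact n * B ^ n"
    by (rule real_analytic_at_deriv_bound) blast
  define s where "s = (\<lambda>k. r (Suc k))"
  obtain q where q: "q \<in> \<rat>" "t0 - \<rho> < q" "q < t0 + \<rho>"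
    using Rats_dense_in_real[of "t0 - \<rho>" "t0 + \<rho>"] b by auto
  have "q \<in> r ` {1..}" using q r by (simp add: bij_betw_def)
  then obtain j where j: "s j = q"
    by (auto simp: s_def) (metis Suc_le_D One_nat_def)
  have inj: "inj s"
    using r by (auto simp: s_def inj_on_def bij_betw_def)
  have x1: "x + 1 > 0" using x by simp
  show False
  proof (rule superposition_derivs_not_geometric[where \<psi> = "\<lambda>n t. heat_kernel_deriv (replicate n False) (x + 1, t)"
        and w = "\<lambda>k. (1/2) ^ Suc k" and s = s and j = j, OF heat_kernel_time_derivs[OF x1]])
    show "\<exists>K. \<forall>t. \<bar>heat_kernel_deriv (replicate n False) (x + 1, t)\<bar> \<le> K" for n
      using heat_kernel_deriv_bounded[OF x1, of "x + 1" "replicate n False"] by (metis fst_conv order_refl)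
    show "heat_kernel_deriv (replicate 0 False) (x + 1, t) \<noteq> 0" if "t > 0" for t
      using that by (simp add: heat_kernel_deriv_Nil heat_kernel_def)
    show "summable (\<lambda>k. (1/2) ^ Suc k :: real)" using summable_half_powers[of 1] by simp
    show "\<bar>\<Sum>k. (1/2) ^ Suc k * heat_kernel_deriv (replicate n False) (x + 1, t - s k)\<bar> \<le> C * fact n * B ^ n"
      if "\<bar>t - t0\<bar> < \<rho>" for n t
      using ub[OF that, of n] unfolding d u2_term_def s_def by simp
  qed (use heat_kernel_deriv_nonpos heat_kernel_time_derivs_tail[OF x1] inj j q b in auto)
qed

theorem theorem1p1:
  fixes r :: "nat \<Rightarrow> real"
  assumes "bij_betw r {1..} \<rat>"
  shows "\<forall>u \<in> {u1, u2 r}.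
           smooth_on_closed Omega1_closure u \<and> Linf_on Omega1 u \<and>
           smooth_heat_on_closed Omega1_closure u \<and>
           (\<forall>x0 \<ge> 0. \<forall>t0. \<not> real_analytic_at (\<lambda>t. u (x0, t)) t0)"
proof -
  \<comment> \<open>The value \<open>d = 1\<close> fits x > 0: there the factor
    \<open>exp (- 2 ^ k)\<close> alone provides a summable majorant.\<close>
  have "\<bar>u1_term k [] p\<bar> \<le> exp (- (2 ^ Suc k * 1))" if "fst p > 0" for k and p :: "real \<times> real"
    using u1_term_bound[of 1 p k "[]"] that by simp
  moreover have "summable (\<lambda>k. exp (- (2 ^ Suc k * 1)) :: real)"
    using summable_osc_bound[of 1 0] by simp
  ultimately have 1: "smooth_on_closed Omega1_closure u1 \<and> Linf_on Omega1 u1 \<and> smooth_heat_on_closed Omega1_closure u1"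
    unfolding u1_eq
    by (intro conjI heat_series osc_has_derivative u1_locally_dominated osc_heat) auto
  obtain K where K: "\<And>r k p. fst p > 0 \<Longrightarrow> \<bar>u2_term r k [] p\<bar> \<le> (1/2) ^ Suc k * K"
    using u2_term_bound by blast
  have heat: "u2_term r k [False] p = u2_term r k [True, True] p" for k p
    by (simp only: u2_term_def heat_kernel_deriv_heat)
  note hs = heat_series[where F = "u2_term r", 
      OF u2_term_has_derivative u2_locally_dominated heat summable_half_powers K, folded u2_eq]
  have "\<not> real_analytic_at (\<lambda>t. u2 r (x0, t)) t0" if "x0 \<ge> 0" for x0 t0
  proof (rule u2_not_analytic[OF assms])
    show "x0 > -1" using that by simp
    then show "(deriv ^^ n) (\<lambda>t. u2 r (x0, t)) t = (\<Sum>k. u2_term r k (replicate n False) (x0, t))" for n t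
      using hs(4)[of x0 n t] by (simp only: u2_eq)
  qed
  moreover have "\<not> real_analytic_at (\<lambda>t. u1 (x0, t)) t0" if "x0 \<ge> 0" for x0 t0
    using u1_not_analytic that by simp
  ultimately show ?thesis using 1 hs(1-3) by blast
qed

end
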